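(* Let $(X(t),Y(t))$ be the planar random motion defined in the context, with Poisson rate $\lambda$, speed $c$ and turning probabilities $p$ (counterclockwise), $q$ (clockwise), $1-p-q$ (reflection). The characteristic function (with argument $\alpha$) of $(X(t),Y(t))$ on the horizontal diagonal of the square $S_{ct}=\{(x,y)\in\mathbb{R}^2:|x|+|y|\le ct\}$ is $$\mathbb{E}\left[e^{i\alpha X(t)}\,\mathbf{1}_{\{Y(t)=0\}}\right]=\frac{e^{-\lambda t}}{4}\left[\left(1+\frac{\lambda(1-p-q)}{\sqrt{\lambda^2(1-p-q)^2-\alpha^2c^2}}\right)e^{t\sqrt{\lambda^2(1-p-q)^2-\alpha^2c^2}}+\left(1-\frac{\lambda(1-p-q)}{\sqrt{\lambda^2(1-p-q)^2-\alpha^2c^2}}\right)e^{-t\sqrt{\lambda^2(1-p-q)^2-\alpha^2c^2}}\right].$$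
   Context: Model. Let $d_j=(\cos(\pi j/2),\sin(\pi j/2))$, with index $j$ taken modulo 4. Let $N(t)$ be a homogeneous Poisson process of rate $\lambda$. The direction process $D(t)$ takes values in $\{d_0,d_1,d_2,d_3\}$; $D(0)$ is uniformly distributed; $D$ is constant between Poisson events; at each Poisson event $D$ jumps from its current value $d_j$ to $d_{j+1}$ with probability $p$ (counterclockwise turn), to $d_{j-1}$ with probability $q$ (clockwise turn), and to $d_{j+2}$ with probability $1-p-q$ (reflection); the initial direction, the Poisson process and the successive choices of turn are independent. The motion starts at the origin and has speed $c$: $(X(t),Y(t))=c\int_0^t D(\tau)\,d\tau$, and its support at time $t$ is the square $S_{ct}$. Square roots of negative real numbers are complex square roots. *)

theory Defs
  imports "HOL-Probability.Probability"
begin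

definition dir :: "int \<Rightarrow> real \<times> real" where
  "dir j = (cos (pi * real_of_int j / 2), sin (pi * real_of_int j / 2))"

text \<open>
  \<open>dir\<close> has period 4, so the index may be accumulated in the integers.
\<close>

lemma dir_mod_4: "dir (j mod 4) = dir j"
proof -
  have *: "pi * real_of_int j / 2 = pi * real_of_int (j mod 4) / 2 + 2 * pi * real_of_int (j div 4)"
  proof -
    have "real_of_int j = real_of_int (j mod 4) + 4 * real_of_int (j div 4)"
      by (metis add.commute mult_div_mod_eq of_int_add of_int_mult of_int_numeral)
    then have "pi * real_of_int j / 2 = pi * (real_of_int (j mod 4) + 4 * real_of_int (j div 4)) / 2"
      by simp
    then show ?thesis by (simp add: field_simps)
  qed
  show ?thesis
    unfolding dir_def * by (simp add: cos_add sin_add)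
qed

definition (in prob_space) poisson_process :: "real \<Rightarrow> (real \<Rightarrow> 'a \<Rightarrow> nat) \<Rightarrow> bool" where
  "poisson_process rate N \<longleftrightarrow>
     rate > 0 \<and>
     (\<forall>t\<ge>0. N t \<in> measurable M (count_space UNIV)) \<and>
     (\<forall>\<omega>\<in>space M. N 0 \<omega> = 0 \<and> mono_on {0..} (\<lambda>t. N t \<omega>) \<and>
        (\<forall>t\<ge>0. continuous (at_right t) (\<lambda>u. N u \<omega>))) \<and>
     (\<forall>s\<ge>0. \<forall>t>s. distr M (count_space UNIV) (\<lambda>\<omega>. N t \<omega> - N s \<omega>)
        = measure_pmf (poisson_pmf (rate * (t - s)))) \<and>
     (\<forall>s. 0 \<le> s 0 \<and> incseq s \<longrightarrow>
        indep_vars (\<lambda>_. count_space UNIV) (\<lambda>i \<omega>. N (s (Suc i)) \<omega> - N (s i) \<omega>) (UNIV :: nat set))"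

text \<open>
  Three kinds of independent sources of randomness: the initial direction, the whole
  Poisson process, and each individual turn.  Joint independence is stated for the
  sigma-algebras they generate.
\<close>

datatype source = Initial | Clock | Turn nat

primrec source_events ::
  "'a measure \<Rightarrow> (real \<Rightarrow> 'a \<Rightarrow> nat) \<Rightarrow> ('a \<Rightarrow> int) \<Rightarrow> (nat \<Rightarrow> 'a \<Rightarrow> int) \<Rightarrow> source \<Rightarrow> 'a set set"
where
  "source_events M N J \<xi> Initial = {J -` A \<inter> space M | A. True}"
| "source_events M N J \<xi> Clock =
     sigma_sets (space M) {N t -` A \<inter> space M | t A. t \<ge> 0}"
| "source_events M N J \<xi> (Turn k) = {\<xi> k -` A \<inter> space M | A. True}"

text \<open>
  \<open>J\<close> is the index of the initial direction and \<open>\<xi> k\<close> the index increment at the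
  \<open>(k + 1)\<close>-st Poisson event: \<open>1\<close> is a counterclockwise turn, \<open>-1\<close> a clockwise turn,
  \<open>2\<close> a reflection.  The three probabilities add up to one, so other values of \<open>\<xi> k\<close>
  have probability zero.
\<close>

locale orthogonal_motion = prob_space M for M :: "'a measure" +
  fixes rate c p q :: real
    and N :: "real \<Rightarrow> 'a \<Rightarrow> nat"
    and J :: "'a \<Rightarrow> int"
    and \<xi> :: "nat \<Rightarrow> 'a \<Rightarrow> int"
  assumes speed_pos: "c > 0"
    and turn_probs: "p \<ge> 0" "q \<ge> 0" "p + q \<le> 1"
    and poisson: "poisson_process rate N"
    and J_measurable: "J \<in> measurable M (count_space UNIV)"
    and J_uniform: "distr M (count_space UNIV) J = measure_pmf (pmf_of_set {0, 1, 2, 3})"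
    and turn_measurable: "\<And>k. \<xi> k \<in> measurable M (count_space UNIV)"
    and turn_ccw: "\<And>k. prob {\<omega> \<in> space M. \<xi> k \<omega> = 1} = p"
    and turn_cw: "\<And>k. prob {\<omega> \<in> space M. \<xi> k \<omega> = - 1} = q"
    and turn_reflect: "\<And>k. prob {\<omega> \<in> space M. \<xi> k \<omega> = 2} = 1 - p - q"
    and sources_indep: "indep_sets (source_events M N J \<xi>) UNIV"

definition direction ::
  "(real \<Rightarrow> 'a \<Rightarrow> nat) \<Rightarrow> ('a \<Rightarrow> int) \<Rightarrow> (nat \<Rightarrow> 'a \<Rightarrow> int) \<Rightarrow> real \<Rightarrow> 'a \<Rightarrow> real \<times> real" where
  "direction N J \<xi> t \<omega> = dir (J \<omega> + (\<Sum>k<N t \<omega>. \<xi> k \<omega>))"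

definition position ::
  "real \<Rightarrow> (real \<Rightarrow> 'a \<Rightarrow> nat) \<Rightarrow> ('a \<Rightarrow> int) \<Rightarrow> (nat \<Rightarrow> 'a \<Rightarrow> int) \<Rightarrow> real \<Rightarrow> 'a \<Rightarrow> real \<times> real" where
  "position c N J \<xi> t \<omega> = c *\<^sub>R integral {0..t} (\<lambda>s. direction N J \<xi> s \<omega>)"

definition diagonal_root :: "real \<Rightarrow> real \<Rightarrow> real \<Rightarrow> real \<Rightarrow> real \<Rightarrow> complex" where
  "diagonal_root rate c p q \<alpha> =
     csqrt (complex_of_real (rate\<^sup>2 * (1 - p - q)\<^sup>2 - \<alpha>\<^sup>2 * c\<^sup>2))"

text \<open>
  At a zero of \<open>diagonal_root\<close> the formula below is meaningless (division by zero returns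
  zero) and has to be read as a limit in \<open>\<alpha>\<close>.
\<close>

definition diagonal_formula :: "real \<Rightarrow> real \<Rightarrow> real \<Rightarrow> real \<Rightarrow> real \<Rightarrow> real \<Rightarrow> complex" where
  "diagonal_formula rate c p q t \<alpha> =
     complex_of_real (exp (- rate * t)) / 4 *
       ((1 + complex_of_real (rate * (1 - p - q)) / diagonal_root rate c p q \<alpha>)
           * exp (complex_of_real t * diagonal_root rate c p q \<alpha>)
      + (1 - complex_of_real (rate * (1 - p - q)) / diagonal_root rate c p q \<alpha>)
           * exp (- complex_of_real t * diagonal_root rate c p q \<alpha>))"

end

theory Submission
  imports Defs
begin

text \<open>
  Let \<open>Z\<close> be the integral over \<open>[0, t]\<close> of \<open>(-1)^N\<close> and \<open>r = 1 - p - q\<close>.  Up to null sets the motion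
  ends on the horizontal diagonal iff it starts horizontally and is reflected at each of the first \<open>N t\<close>
  events; then it ends at abscissa \<open>c Z\<close> or \<open>- c Z\<close>.  Averaging over the directions leaves
  \<open>E[r^N(t) exp(i a Z)] / 4\<close> with \<open>a = \<alpha> c\<close> and \<open>a = - \<alpha> c\<close>.

  Both probabilistic facts are obtained on a grid of mesh \<open>h\<close>, where the increments of \<open>N\<close> are
  independent, and by letting \<open>h\<close> tend to 0; the Riemann sums of a function of \<open>N\<close> converge with an
  error of order \<open>h\<close> that is explicit in the final value of \<open>N\<close>.  A cancellation of non-constant vertical
  displacements has probability 0, because on \<open>N t = k\<close> the probability that the Riemann sum is within
  \<open>e\<close> of a given point is \<open>O(e + h)\<close>, by induction on \<open>k\<close> over the place of the last jump.  The
  discretised expectations of \<open>r^N exp(i a Z)\<close> and \<open>(-r)^N exp(i a Z)\<close> satisfy an exact linear recursion in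
  the plane, which is, up to the factor \<open>exp (-\<lambda>t)\<close>, a consistent one-step scheme for the flow of
  the matrix \<open>((\<lambda>r, ia), (ia, -\<lambda>r))\<close>, whose square is the scalar \<open>\<lambda>\<^sup>2r\<^sup>2 - a\<^sup>2\<close>.  At the zeros of that
  scalar the formula follows from the continuity of the characteristic function.
\<close>

section \<open>Riemann sums along counting paths\<close>

lemma mono_on_riemann_sum_bounds:
  fixes g :: "real \<Rightarrow> real"
  assumes g: "mono_on {0..} g" and h: "0 < h"
  shows "h * (\<Sum>i<m. g (real i * h)) \<le> integral {0..real m * h} g"
    and "integral {0..real m * h} g \<le> h * (\<Sum>i<m. g (real (Suc i) * h))"
proof -
  have int: "g integrable_on {a..b}" if "0 \<le> a" for a b
    using that by (intro integrable_on_mono_on mono_on_subset[OF g]) auto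
  have "h * (\<Sum>i<m. g (real i * h)) \<le> integral {0..real m * h} g \<and>
    integral {0..real m * h} g \<le> h * (\<Sum>i<m. g (real (Suc i) * h))"
  proof (induction m)
    case (Suc m)
    let ?a = "real m * h" and ?b = "real (Suc m) * h"
    have ab: "0 \<le> ?a" "?a \<le> ?b" using h by (auto simp: mult_right_mono)
    have split: "integral {0..?b} g = integral {0..?a} g + integral {?a..?b} g"
      using ab by (intro Henstock_Kurzweil_Integration.integral_combine[symmetric] int) auto
    have "integral {?a..?b} (\<lambda>_. g ?a) \<le> integral {?a..?b} g"
      using ab by (intro integral_le int) (auto intro!: mono_onD[OF g])
    moreover have "integral {?a..?b} g \<le> integral {?a..?b} (\<lambda>_. g ?b)"
      using ab by (intro integral_le int) (auto intro!: mono_onD[OF g])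
    moreover have "?b - ?a = h" by (simp add: algebra_simps)
    ultimately have "h * g ?a \<le> integral {?a..?b} g" "integral {?a..?b} g \<le> h * g ?b"
      using ab by simp_all
    then show ?case using Suc.IH unfolding split by (simp add: algebra_simps)
  qed simp
  then show "h * (\<Sum>i<m. g (real i * h)) \<le> integral {0..real m * h} g"
    and "integral {0..real m * h} g \<le> h * (\<Sum>i<m. g (real (Suc i) * h))" by auto
qed

text \<open>The left and right sums enclose the integral, and their difference telescopes to a
  boundary term.\<close>

lemma mono_on_riemann_sum_error:
  fixes g :: "real \<Rightarrow> real"
  assumes g: "mono_on {0..} g" and h: "0 < h"
  shows "\<bar>integral {0..real m * h} g - h * (\<Sum>i<m. g (real i * h))\<bar>
    \<le> h * (g (real m * h) - g 0)"
proof -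
  have "h * (\<Sum>i<m. g (real (Suc i) * h)) - h * (\<Sum>i<m. g (real i * h)) =
      h * (g (real m * h) - g 0)"
    unfolding right_diff_distrib[symmetric] sum_subtractf[symmetric]
    by (subst sum_lessThan_telescope[of "\<lambda>i. g (real i * h)"]) simp
  then show ?thesis
    using mono_on_riemann_sum_bounds[OF assms, of m] by linarith
qed

text \<open>Layer decomposition: a function of a counting path is a finite combination of the
  monotone indicators \<open>u k\<close>, each with Riemann error at most h. Since
  \<open>f k\<close> is weighted by a difference of two such indicators, its error is at most 2h.
  The number of layers is governed by the final value of the path, so no bound on f enters.\<close>

lemma counting_path_integral:
  fixes n :: "real \<Rightarrow> nat" and f :: "nat \<Rightarrow> 'b::euclidean_space"
  assumes n: "mono_on {0..} n"
  shows "(\<lambda>s. f (n s)) integrable_on {0..t}"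
    and "0 < h \<Longrightarrow> norm (integral {0..real m * h} (\<lambda>s. f (n s)) - h *\<^sub>R (\<Sum>i<m. f (n (real i * h))))
      \<le> h * (\<Sum>k\<le>n (real m * h). 2 * norm (f k))"
proof -
  define u :: "nat \<Rightarrow> real \<Rightarrow> real" where "u k s = of_bool (k \<le> n s)" for k s
  have mono: "mono_on {0..} (u k)" for k
    using n by (auto simp: u_def mono_on_def intro: order_trans)
  have int: "u k integrable_on {0..t}" for k t
    by (intro integrable_on_mono_on mono_on_subset[OF mono]) auto
  \<comment> \<open>The indicator of \<open>n s = k\<close> is \<open>u k s - u (Suc k) s\<close>;
    summing up to the value at the right end covers the whole interval.\<close>
  have rep: "f (n s) = (\<Sum>k\<le>n t. (u k s - u (Suc k) s) *\<^sub>R f k)" if "s \<in> {0..t}" for s t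
  proof -
    have "n s \<le> n t" using that by (intro mono_onD[OF n]) auto
    have "(\<Sum>k\<le>n t. (u k s - u (Suc k) s) *\<^sub>R f k) = (\<Sum>k\<le>n t. if k = n s then f k else 0)"
      by (intro sum.cong) (auto simp: u_def)
    then show ?thesis using \<open>n s \<le> n t\<close> by simp
  qed
  have hi: "((\<lambda>s. f (n s)) has_integral
      (\<Sum>k\<le>n t. (integral {0..t} (u k) - integral {0..t} (u (Suc k))) *\<^sub>R f k)) {0..t}" for t
    by (subst has_integral_cong[OF rep])
       (auto intro!: has_integral_sum has_integral_scaleR_left has_integral_diff integrable_integral int)
  show "(\<lambda>s. f (n s)) integrable_on {0..t}"
    using hi by blast
  assume h: "0 < h"
  define e where "e k = integral {0..real m * h} (u k) - h * (\<Sum>i<m. u k (real i * h))" for k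
  have e: "\<bar>e k\<bar> \<le> h" for k
  proof -
    have "h * (u k (real m * h) - u k 0) \<le> h * 1"
      using h by (intro mult_left_mono) (auto simp: u_def)
    then show ?thesis
      using mono_on_riemann_sum_error[OF mono[of k] h, of m] unfolding e_def by linarith
  qed
  have "h *\<^sub>R (\<Sum>i<m. f (n (real i * h))) =
    h *\<^sub>R (\<Sum>i<m. \<Sum>k\<le>n (real m * h). (u k (real i * h) - u (Suc k) (real i * h)) *\<^sub>R f k)"
    using h by (intro arg_cong[where f = "scaleR h"] sum.cong rep) auto
  also have "\<dots> = (\<Sum>k\<le>n (real m * h).
      (h * (\<Sum>i<m. u k (real i * h)) - h * (\<Sum>i<m. u (Suc k) (real i * h))) *\<^sub>R f k)"
  proof -
    have "h *\<^sub>R (\<Sum>i<m. (u k (real i * h) - u (Suc k) (real i * h)) *\<^sub>R f k) =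
      (h * (\<Sum>i<m. u k (real i * h)) - h * (\<Sum>i<m. u (Suc k) (real i * h))) *\<^sub>R f k" for k
      unfolding scaleR_sum_left[symmetric] scaleR_scaleR right_diff_distrib[symmetric] sum_subtractf ..
    then show ?thesis
      by (subst sum.swap) (simp add: scaleR_sum_right)
  qed
  finally have "integral {0..real m * h} (\<lambda>s. f (n s)) - h *\<^sub>R (\<Sum>i<m. f (n (real i * h))) =
    (\<Sum>k\<le>n (real m * h). (e k - e (Suc k)) *\<^sub>R f k)"
    unfolding integral_unique[OF hi] e_def
    by (simp only: sum_subtractf[symmetric] scaleR_left_diff_distrib[symmetric])
      (simp add: algebra_simps)
  also have "norm \<dots> \<le> (\<Sum>k\<le>n (real m * h). 2 * h * norm (f k))"
  proof (intro sum_norm_le)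
    fix k
    have "\<bar>e k - e (Suc k)\<bar> \<le> 2 * h" using e[of k] e[of "Suc k"] by linarith
    then show "norm ((e k - e (Suc k)) *\<^sub>R f k) \<le> 2 * h * norm (f k)"
      by (simp add: mult_right_mono)
  qed
  finally show "norm (integral {0..real m * h} (\<lambda>s. f (n s)) - h *\<^sub>R (\<Sum>i<m. f (n (real i * h))))
      \<le> h * (\<Sum>k\<le>n (real m * h). 2 * norm (f k))"
    by (simp add: sum_distrib_left mult_ac)
qed

section \<open>Poisson increments on a grid\<close>

text \<open>Negative z matter as well: the recursion for the characteristic functions is used at
  both r and - r.\<close>

lemma poisson_pmf_gen:
  fixes z :: real
  assumes "0 < \<mu>" "\<bar>z\<bar> \<le> 1"
  shows "measure_pmf.expectation (poisson_pmf \<mu>) (\<lambda>k. z ^ k) = exp (- \<mu> * (1 - z))"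
proof -
  let ?f = "\<lambda>k. pmf (poisson_pmf \<mu>) k *\<^sub>R z ^ k"
  have f: "?f = (\<lambda>k. exp (- \<mu>) * ((\<mu> * z) ^ k /\<^sub>R fact k))"
    using assms by (auto simp: fun_eq_iff power_mult_distrib field_simps)
  have s: "?f sums (exp (- \<mu>) * exp (\<mu> * z))"
    unfolding f by (intro sums_mult exp_converges)
  have "summable (\<lambda>k. norm (?f k))"
    using assms summable_mult[OF sums_summable[OF exp_converges[of "\<mu> * \<bar>z\<bar>"]], of "exp (- \<mu>)"]
    by (simp add: power_mult_distrib field_simps abs_mult power_abs)
  then have "integrable (count_space UNIV) ?f"
    by (simp add: integrable_count_space_nat_iff)
  then have "?f sums (\<integral>k. ?f k \<partial>count_space UNIV)"
    by (rule sums_integral_count_space_nat)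
  then have "(\<integral>k. ?f k \<partial>count_space UNIV) = exp (- \<mu>) * exp (\<mu> * z)"
    using s by (rule sums_unique2)
  moreover have "measure_pmf.expectation (poisson_pmf \<mu>) (\<lambda>k. z ^ k) = (\<integral>k. ?f k \<partial>count_space UNIV)"
    unfolding measure_pmf_eq_density by (subst integral_density) (auto simp del: pmf_poisson)
  ultimately show ?thesis by (simp add: exp_add[symmetric] algebra_simps)
qed

lemma poisson_pmf_ge_1:
  assumes "0 < \<mu>"
  shows "measure_pmf.prob (poisson_pmf \<mu>) {1..} \<le> \<mu>"
proof -
  have "{1..} = UNIV - {0::nat}" by auto
  then have "measure_pmf.prob (poisson_pmf \<mu>) {1..} = 1 - exp (- \<mu>)"
    using assms by (simp only: measure_pmf.prob_compl[of "{0}", simplified]) (simp add: measure_pmf_single)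
  then show ?thesis using exp_ge_add_one_self[of "- \<mu>"] by linarith
qed

lemma poisson_pmf_ge_2:
  assumes "0 < \<mu>"
  shows "measure_pmf.prob (poisson_pmf \<mu>) {2..} \<le> \<mu>\<^sup>2"
proof -
  have "{2..} = UNIV - {0, 1::nat}" by auto
  then have "measure_pmf.prob (poisson_pmf \<mu>) {2..} = 1 - (1 + \<mu>) * exp (- \<mu>)"
    using assms by (simp only: measure_pmf.prob_compl[of "{0, 1}", simplified])
      (simp add: measure_measure_pmf_finite algebra_simps)
  moreover have "(1 + \<mu>) * (1 - \<mu>) \<le> (1 + \<mu>) * exp (- \<mu>)"
    using exp_ge_add_one_self[of "- \<mu>"] assms by (intro mult_left_mono) auto
  ultimately show ?thesis by (simp add: power2_eq_square algebra_simps)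
qed

text \<open>The grid values of N are sums of increments only on \<open>space M\<close>, so
  independence has to be transported along equality there.\<close>

lemma (in prob_space) indep_var_cong_space:
  assumes "\<And>\<omega>. \<omega> \<in> space M \<Longrightarrow> X \<omega> = X' \<omega>"
  shows "indep_var K X L Y \<longleftrightarrow> indep_var K X' L Y"
proof -
  have "X -` A \<inter> space M = X' -` A \<inter> space M" for A
    using assms by auto
  moreover have "random_variable K X \<longleftrightarrow> random_variable K X'"
    using assms by (intro measurable_cong)
  ultimately show ?thesis
    by (simp add: indep_var_eq)
qed

locale poisson_clock = prob_space +
  fixes rate :: real and N :: "real \<Rightarrow> 'a \<Rightarrow> nat"
  assumes poisson_process: "poisson_process rate N"
begin

lemma rate_pos: "0 < rate"
  using poisson_process by (simp add: poisson_process_def)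

lemma measurable_N [measurable]: "0 \<le> s \<Longrightarrow> N s \<in> measurable M (count_space UNIV)"
  using poisson_process by (simp add: poisson_process_def)

lemma N_0: "\<omega> \<in> space M \<Longrightarrow> N 0 \<omega> = 0"
  using poisson_process by (simp add: poisson_process_def)

lemma N_mono: "\<omega> \<in> space M \<Longrightarrow> mono_on {0..} (\<lambda>s. N s \<omega>)"
  using poisson_process by (simp add: poisson_process_def)

lemma N_le: "\<omega> \<in> space M \<Longrightarrow> 0 \<le> s \<Longrightarrow> s \<le> s' \<Longrightarrow> N s \<omega> \<le> N s' \<omega>"
  using mono_onD[OF N_mono, of \<omega> s s'] by auto

lemma distr_increment:
  "0 \<le> s \<Longrightarrow> s < s' \<Longrightarrow>
    distr M (count_space UNIV) (\<lambda>\<omega>. N s' \<omega> - N s \<omega>) = measure_pmf (poisson_pmf (rate * (s' - s)))"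
  using poisson_process by (simp add: poisson_process_def)

text \<open>The truncated subtraction is the true difference on \<open>space M\<close> by
  monotonicity, as \<open>N_Suc_grid\<close> records.\<close>

definition incr :: "real \<Rightarrow> nat \<Rightarrow> 'a \<Rightarrow> nat" where
  "incr h m \<omega> = N (real (Suc m) * h) \<omega> - N (real m * h) \<omega>"

lemma measurable_incr [measurable]: "0 \<le> h \<Longrightarrow> incr h m \<in> measurable M (count_space UNIV)"
  unfolding incr_def by measurable

lemma N_Suc_grid:
  "\<omega> \<in> space M \<Longrightarrow> 0 \<le> h \<Longrightarrow> N (real (Suc m) * h) \<omega> = N (real m * h) \<omega> + incr h m \<omega>"
  using N_le[of \<omega> "real m * h" "real (Suc m) * h"] by (simp add: incr_def mult_right_mono)

lemma N_grid:
  "\<omega> \<in> space M \<Longrightarrow> 0 \<le> h \<Longrightarrow> N (real m * h) \<omega> = (\<Sum>i<m. incr h i \<omega>)"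
  by (induction m) (simp_all add: N_0 N_Suc_grid del: of_nat_Suc)

lemma distr_incr:
  "0 < h \<Longrightarrow> distr M (count_space UNIV) (incr h m) = measure_pmf (poisson_pmf (rate * h))"
  using distr_increment[of "real m * h" "real (Suc m) * h"]
  unfolding incr_def by (simp add: algebra_simps)

lemma prob_incr:
  assumes "0 < h"
  shows "prob {\<omega> \<in> space M. incr h m \<omega> \<in> A} = measure_pmf.prob (poisson_pmf (rate * h)) A"
proof -
  have "measure (distr M (count_space UNIV) (incr h m)) A = prob (incr h m -` A \<inter> space M)"
    using assms by (intro measure_distr) auto
  then show ?thesis
    unfolding distr_incr[OF assms] by (simp add: vimage_def Collect_conj_eq Int_commute)
qed

lemma prob_incr_ge_1: "0 < h \<Longrightarrow> prob {\<omega> \<in> space M. 1 \<le> incr h m \<omega>} \<le> rate * h"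
  using prob_incr[of h m "{1..}"] poisson_pmf_ge_1[of "rate * h"] rate_pos by simp

lemma prob_incr_ge_2: "0 < h \<Longrightarrow> prob {\<omega> \<in> space M. 2 \<le> incr h m \<omega>} \<le> (rate * h)\<^sup>2"
  using prob_incr[of h m "{2..}"] poisson_pmf_ge_2[of "rate * h"] rate_pos by simp

lemma expectation_power_incr:
  fixes z :: real
  assumes "0 < h" "\<bar>z\<bar> \<le> 1"
  shows "expectation (\<lambda>\<omega>. z ^ incr h m \<omega>) = exp (- (rate * h) * (1 - z))"
proof -
  have "expectation (\<lambda>\<omega>. z ^ incr h m \<omega>) = integral\<^sup>L (distr M (count_space UNIV) (incr h m)) (\<lambda>k. z ^ k)"
    using assms by (subst integral_distr) auto
  then show ?thesis
    unfolding distr_incr[OF assms(1)] using poisson_pmf_gen[of "rate * h" z] assms rate_pos by simp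
qed

text \<open>The path up to grid index m is a function of the increments before m, which are
  independent of the m-th one. Increments take values in a countable discrete space and only
  finitely many are involved, so the product space is discrete and any F and G are
  measurable.\<close>

lemma indep_past_incr:
  assumes h: "0 < h" and sp: "space K = UNIV" "space L = UNIV"
    and F: "\<And>x x'. (\<And>i. i \<le> m \<Longrightarrow> x i = x' i) \<Longrightarrow> F x = F x'"
  shows "indep_var K (\<lambda>\<omega>. F (\<lambda>i. N (real i * h) \<omega>)) L (\<lambda>\<omega>. G (incr h m \<omega>))"
proof -
  have "incseq (\<lambda>i. real i * h)" using h by (auto simp: incseq_def mult_right_mono)
  then have "indep_vars (\<lambda>_. count_space UNIV)
      (\<lambda>i \<omega>. N (real (Suc i) * h) \<omega> - N (real i * h) \<omega>) (UNIV :: nat set)"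
    using poisson_process unfolding poisson_process_def by (elim conjE allE[of _ "\<lambda>i. real i * h"]) simp
  then have iv: "indep_vars (\<lambda>_. count_space UNIV) (incr h) (UNIV :: nat set)"
    by (simp add: incr_def[abs_def])
  have PiM: "PiM A (\<lambda>_. count_space UNIV) = count_space (PiE A (\<lambda>_. UNIV :: nat set))" if "finite A" for A :: "nat set"
    using that by (intro count_space_PiM_finite) auto
  \<comment> \<open>Y rebuilds the path from its increments. After \<open>restrict\<close> those
    from index m on are meaningless, so the rebuilt path is right only up to m; the hypothesis on F
    absorbs this.\<close>
  define Y where "Y d = F (\<lambda>i. \<Sum>j<i. d j)" for d :: "nat \<Rightarrow> nat"
  define Z where "Z d = G (d m)" for d :: "nat \<Rightarrow> nat"
  have "indep_var K (Y \<circ> (\<lambda>\<omega>. restrict (\<lambda>i. incr h i \<omega>) {..<m}))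
      L (Z \<circ> (\<lambda>\<omega>. restrict (\<lambda>i. incr h i \<omega>) {m}))"
    by (rule indep_var_compose[OF indep_var_restrict[OF iv]]) (auto simp: PiM sp)
  moreover have "(Z \<circ> (\<lambda>\<omega>. restrict (\<lambda>i. incr h i \<omega>) {m})) = (\<lambda>\<omega>. G (incr h m \<omega>))"
    by (auto simp: Z_def)
  moreover have "(Y \<circ> (\<lambda>\<omega>. restrict (\<lambda>i. incr h i \<omega>) {..<m})) \<omega> = F (\<lambda>i. N (real i * h) \<omega>)"
    if "\<omega> \<in> space M" for \<omega>
    unfolding Y_def o_def by (intro F) (use that h in \<open>auto simp: N_grid intro!: sum.cong\<close>)
  ultimately show ?thesis
    by (subst indep_var_cong_space) auto
qed

end

section \<open>Concentration of path integrals\<close>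

text \<open>Counts the grid intervals that can contain the last jump, once their mutual distance is
  bounded.\<close>

lemma card_le_diameter:
  fixes I :: "nat set"
  assumes "finite I" "\<And>i j. i \<in> I \<Longrightarrow> j \<in> I \<Longrightarrow> real j - real i \<le> R" "0 \<le> R"
  shows "real (card I) \<le> R + 1"
proof (cases "I = {}")
  case False
  have "I \<subseteq> {Min I..Max I}" using assms(1) by auto
  then have "card I \<le> card {Min I..Max I}" by (intro card_mono) auto
  also have "\<dots> = Max I - Min I + 1"
    using assms(1) False by (simp add: Suc_diff_le)
  finally have "real (card I) \<le> real (Max I - Min I + 1)" by (rule of_nat_mono)
  also have "\<dots> = real (Max I) - real (Min I) + 1"
    using assms(1) False by (simp add: of_nat_diff)
  also have "real (Max I) - real (Min I) \<le> R"
    using assms(1) False by (intro assms(2)) auto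
  finally show ?thesis by simp
qed (use assms in simp)

context poisson_clock
begin

text \<open>Left endpoints make the sum over m cells a function of the past of
  \<open>incr h m\<close>, hence independent of it.\<close>

definition grid_sum :: "real \<Rightarrow> (nat \<Rightarrow> real) \<Rightarrow> nat \<Rightarrow> 'a \<Rightarrow> real" where
  "grid_sum h y m \<omega> = h * (\<Sum>i<m. y (N (real i * h) \<omega>))"

lemma grid_sum_Suc: "grid_sum h y (Suc m) \<omega> = grid_sum h y m \<omega> + h * y (N (real m * h) \<omega>)"
  by (simp add: grid_sum_def algebra_simps)

lemma measurable_grid_sum [measurable]:
  "0 \<le> h \<Longrightarrow> grid_sum h y m \<in> borel_measurable M"
  unfolding grid_sum_def
  by (intro borel_measurable_times borel_measurable_sum borel_measurable_const
      measurable_compose[OF measurable_N]) auto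

text \<open>
  The index \<open>i\<close> is the last grid interval in which \<open>N\<close> jumps, so that the sum beyond it is deterministic.
\<close>

lemma last_grid_jump:
  assumes "\<omega> \<in> space M" "0 < h" "N (real m * h) \<omega> = Suc k"
  shows "\<exists>i<m. N (real i * h) \<omega> \<le> k \<and> N (real i * h) \<omega> + incr h i \<omega> = Suc k \<and>
    grid_sum h y m \<omega> =
      grid_sum h y i \<omega> + h * (y (N (real i * h) \<omega>) + (real m - real i - 1) * y (Suc k))"
  using assms(3)
proof (induction m)
  case 0
  then show ?case using N_0 assms by simp
next
  case (Suc m)
  have eq: "N (real m * h) \<omega> + incr h m \<omega> = Suc k"
    using Suc.prems N_Suc_grid[of \<omega> h m] assms by simp
  show ?case
  proof (cases "N (real m * h) \<omega> = Suc k")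
    case True
    then obtain i where i: "i < m" "N (real i * h) \<omega> \<le> k" "N (real i * h) \<omega> + incr h i \<omega> = Suc k"
      "grid_sum h y m \<omega> =
        grid_sum h y i \<omega> + h * (y (N (real i * h) \<omega>) + (real m - real i - 1) * y (Suc k))"
      using Suc.IH by blast
    have "grid_sum h y (Suc m) \<omega> = grid_sum h y m \<omega> + h * y (Suc k)"
      by (simp only: grid_sum_Suc True)
    with i show ?thesis
      by (intro exI[of _ i]) (simp add: algebra_simps)
  next
    case False
    then show ?thesis
      using eq by (intro exI[of _ m]) (simp add: grid_sum_Suc)
  qed
qed

definition near :: "real \<Rightarrow> (nat \<Rightarrow> real) \<Rightarrow> nat \<Rightarrow> nat \<Rightarrow> real \<Rightarrow> real \<Rightarrow> 'a set" where
  "near h y m k x e = {\<omega> \<in> space M. N (real m * h) \<omega> = k \<and> \<bar>grid_sum h y m \<omega> - x\<bar> \<le> e}"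

lemma sets_near [measurable]: "0 \<le> h \<Longrightarrow> near h y m k x e \<in> events"
  unfolding near_def by measurable

lemma prob_near_incr:
  assumes "0 < h"
  shows "prob (near h y m k x e \<inter> {\<omega> \<in> space M. 1 \<le> incr h m \<omega>}) \<le> prob (near h y m k x e) * (rate * h)"
proof -
  let ?F = "\<lambda>n :: nat \<Rightarrow> nat. n m = k \<and> \<bar>h * (\<Sum>i<m. y (n i)) - x\<bar> \<le> e"
  \<comment> \<open>Events are encoded as boolean random variables, so that independence of the
    variables yields the product formula for the events.\<close>
  have "indep_var (count_space UNIV) (\<lambda>\<omega>. ?F (\<lambda>i. N (real i * h) \<omega>))
      (count_space UNIV) (\<lambda>\<omega>. 1 \<le> incr h m \<omega>)"
    by (rule indep_past_incr[OF assms, where F = ?F and G = "\<lambda>d. 1 \<le> d"]) simp_all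
  from indep_varD[OF this, of "{True}" "{True}"]
  have "prob (near h y m k x e \<inter> {\<omega> \<in> space M. 1 \<le> incr h m \<omega>}) =
      prob (near h y m k x e) * prob {\<omega> \<in> space M. 1 \<le> incr h m \<omega>}"
    by (simp add: near_def grid_sum_def vimage_def Int_def conj_ac cong: conj_cong)
  also have "\<dots> \<le> prob (near h y m k x e) * (rate * h)"
    by (intro mult_left_mono prob_incr_ge_1 assms) auto
  finally show ?thesis .
qed

text \<open>C is uniform in the mesh, the number of cells and the centre x; the induction shifts the
  centre, so x must be arbitrary. If y is constant up to k, the position of the last jump determines
  the sum, and few positions are compatible with a small window. Otherwise the sum before the last
  jump is itself spread out by the induction hypothesis. For k = 0 the hypothesis is
  contradictory.\<close>

lemma grid_concentration:
  assumes "\<exists>i\<le>k. y i \<noteq> y 0" and t: "0 \<le> t"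
  shows "\<exists>C\<ge>0. \<forall>h m x e. 0 < h \<longrightarrow> real m * h \<le> t \<longrightarrow> 0 \<le> e \<longrightarrow> prob (near h y m k x e) \<le> C * (e + h)"
  using assms(1)
proof (induction k)
  case (Suc k)
  show ?case
  proof (cases "\<exists>i\<le>k. y i \<noteq> y 0")
    case False
    then have y: "y i = y 0" if "i \<le> k" for i using that by blast
    define d where "d = \<bar>y 0 - y (Suc k)\<bar>"
    have d: "0 < d" using Suc.prems y unfolding d_def by (metis le_Suc_eq zero_less_abs_iff right_minus_eq)
    have "prob (near h y m (Suc k) x e) \<le> (2 * rate / d + rate) * (e + h)"
      if h: "0 < h" and "real m * h \<le> t" and e: "0 \<le> e" for h m x e
    proof -
      \<comment> \<open>The value of the sum when the last jump lies in cell i: the i + 1 left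
        endpoints up to that cell see y 0, the other m - i - 1 see the final value. Consecutive
        values differ by h d.\<close>
      define z where "z i = h * ((real i + 1) * y 0 + (real m - real i - 1) * y (Suc k))" for i
      define I where "I = {i. i < m \<and> \<bar>z i - x\<bar> \<le> e}"
      have fin: "finite I" by (simp add: I_def)
      have sub: "near h y m (Suc k) x e \<subseteq> (\<Union>i\<in>I. {\<omega> \<in> space M. 1 \<le> incr h i \<omega>})"
      proof
        fix \<omega> assume "\<omega> \<in> near h y m (Suc k) x e"
        then have \<omega>: "\<omega> \<in> space M" "N (real m * h) \<omega> = Suc k" "\<bar>grid_sum h y m \<omega> - x\<bar> \<le> e"
          by (auto simp: near_def)
        obtain i where i: "i < m" "N (real i * h) \<omega> \<le> k" "N (real i * h) \<omega> + incr h i \<omega> = Suc k"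
          "grid_sum h y m \<omega> =
            grid_sum h y i \<omega> + h * (y (N (real i * h) \<omega>) + (real m - real i - 1) * y (Suc k))"
          using last_grid_jump[OF \<omega>(1) h \<omega>(2)] by blast
        have "N (real j * h) \<omega> \<le> k" if "j \<le> i" for j
          using N_le[OF \<omega>(1), of "real j * h" "real i * h"] that h i(2) by (auto simp: mult_right_mono)
        then have "(\<Sum>j<i. y (N (real j * h) \<omega>)) = (\<Sum>j<i. y 0)" "y (N (real i * h) \<omega>) = y 0"
          by (intro sum.cong y refl; simp)+
        then have "grid_sum h y i \<omega> = h * (real i * y 0)" "y (N (real i * h) \<omega>) = y 0"
          by (simp_all add: grid_sum_def)
        then have "grid_sum h y m \<omega> = z i"
          unfolding i(4) z_def by (simp add: algebra_simps)
        then have "i \<in> I" using i(1) \<omega>(3) by (auto simp: I_def)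
        then show "\<omega> \<in> (\<Union>i\<in>I. {\<omega> \<in> space M. 1 \<le> incr h i \<omega>})"
          using i(2,3) \<omega>(1) by (intro UN_I[of i]) auto
      qed
      \<comment> \<open>The values \<open>z i\<close> are spaced by h d and those with index in I
        lie in a window of width 2e.\<close>
      have "real (card I) \<le> 2 * e / (h * d) + 1"
      proof (rule card_le_diameter[OF fin])
        fix i j assume "i \<in> I" "j \<in> I"
        have "\<bar>z j - z i\<bar> = \<bar>h * (real j - real i) * (y 0 - y (Suc k))\<bar>"
          by (simp add: z_def algebra_simps)
        also have "\<dots> = h * \<bar>real j - real i\<bar> * d"
          using h by (simp add: abs_mult d_def)
        finally have "h * \<bar>real j - real i\<bar> * d \<le> 2 * e"
          using \<open>i \<in> I\<close> \<open>j \<in> I\<close> by (auto simp: I_def)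
        then have "\<bar>real j - real i\<bar> \<le> 2 * e / (h * d)"
          using h d by (simp add: pos_le_divide_eq mult_ac)
        then show "real j - real i \<le> 2 * e / (h * d)" by linarith
      qed (use h d e in auto)
      then have card: "real (card I) * (rate * h) \<le> (2 * e / (h * d) + 1) * (rate * h)"
        using h rate_pos by (intro mult_right_mono) auto
      have "prob (near h y m (Suc k) x e) \<le> prob (\<Union>i\<in>I. {\<omega> \<in> space M. 1 \<le> incr h i \<omega>})"
        using fin h by (intro finite_measure_mono[OF sub] sets.finite_UN) auto
      also have "\<dots> \<le> (\<Sum>i\<in>I. prob {\<omega> \<in> space M. 1 \<le> incr h i \<omega>})"
        using fin h by (intro finite_measure_subadditive_finite) auto
      also have "\<dots> \<le> real (card I) * (rate * h)"
        by (rule sum_bounded_above) (rule prob_incr_ge_1[OF h])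
      also have "\<dots> \<le> (2 * e / (h * d) + 1) * (rate * h)" by (rule card)
      also have "\<dots> = 2 * rate / d * e + rate * h"
        using h d by (simp add: field_simps)
      also have "\<dots> \<le> (2 * rate / d + rate) * (e + h)"
        using h d e rate_pos by (simp add: algebra_simps add_increasing add_divide_distrib)
      finally show ?thesis .
    qed
    then show ?thesis
      using d rate_pos by (intro exI[of _ "2 * rate / d + rate"]) auto
  next
    case True
    then obtain C where C: "0 \<le> C"
      "\<And>h m x e. 0 < h \<Longrightarrow> real m * h \<le> t \<Longrightarrow> 0 \<le> e \<Longrightarrow> prob (near h y m k x e) \<le> C * (e + h)"
      using Suc.IH by blast
    have "prob (near h y m (Suc k) x e) \<le> (t * rate\<^sup>2 + t * rate * C) * (e + h)"
      if h: "0 < h" and m: "real m * h \<le> t" and e: "0 \<le> e" for h m x e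
    proof -
      \<comment> \<open>The shifted centre: what the sum before cell i must approximate if the path
        jumps from k to k + 1 in that cell and stays there. Paths that arrive from below k jump at
        least twice within one cell and fall into \<open>D i\<close>.\<close>
      define z where "z i = x - h * (y k + (real m - real i - 1) * y (Suc k))" for i
      define E where "E i = near h y i k (z i) e \<inter> {\<omega> \<in> space M. 1 \<le> incr h i \<omega>}" for i
      define D where "D i = {\<omega> \<in> space M. 2 \<le> incr h i \<omega>}" for i
      have ev: "E i \<in> events" "D i \<in> events" for i
        using h by (auto simp: E_def D_def)
      have sub: "near h y m (Suc k) x e \<subseteq> (\<Union>i<m. D i \<union> E i)"
      proof
        fix \<omega> assume "\<omega> \<in> near h y m (Suc k) x e"
        then have \<omega>: "\<omega> \<in> space M" "N (real m * h) \<omega> = Suc k" "\<bar>grid_sum h y m \<omega> - x\<bar> \<le> e"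
          by (auto simp: near_def)
        obtain i where i: "i < m" "N (real i * h) \<omega> \<le> k" "N (real i * h) \<omega> + incr h i \<omega> = Suc k"
          "grid_sum h y m \<omega> =
            grid_sum h y i \<omega> + h * (y (N (real i * h) \<omega>) + (real m - real i - 1) * y (Suc k))"
          using last_grid_jump[OF \<omega>(1) h \<omega>(2)] by blast
        have "\<omega> \<in> E i" if "N (real i * h) \<omega> = k"
          using that i \<omega> by (auto simp: E_def near_def z_def algebra_simps)
        moreover have "\<omega> \<in> D i" if "N (real i * h) \<omega> < k"
          using that i \<omega> by (auto simp: D_def)
        ultimately show "\<omega> \<in> (\<Union>i<m. D i \<union> E i)"
          using i(1,2) by (cases "N (real i * h) \<omega> = k") auto
      qed
      \<comment> \<open>There are m \<le> t / h cells: the double jumps contribute O(h) in total,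
        and the single jumps, each the product of a concentration bound and a jump probability, O(e
        + h).\<close>
      have bound: "prob (D i \<union> E i) \<le> (rate * h)\<^sup>2 + C * (e + h) * (rate * h)" if "i < m" for i
      proof -
        have "real i * h \<le> t" using order_trans[OF mult_right_mono m] that h by auto
        then have "prob (near h y i k (z i) e) * (rate * h) \<le> C * (e + h) * (rate * h)"
          using h e rate_pos by (intro mult_right_mono C) auto
        then have "prob (E i) \<le> C * (e + h) * (rate * h)"
          using prob_near_incr[OF h, of y i k "z i" e] unfolding E_def by linarith
        moreover have "prob (D i) \<le> (rate * h)\<^sup>2"
          unfolding D_def by (rule prob_incr_ge_2[OF h])
        moreover have "prob (D i \<union> E i) \<le> prob (D i) + prob (E i)"
          by (intro measure_Un_le ev)
        ultimately show ?thesis by linarith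
      qed
      have "prob (near h y m (Suc k) x e) \<le> prob (\<Union>i<m. D i \<union> E i)"
        using ev by (intro finite_measure_mono[OF sub] sets.finite_UN) auto
      also have "\<dots> \<le> (\<Sum>i<m. prob (D i \<union> E i))"
        using ev by (intro finite_measure_subadditive_finite) auto
      also have "\<dots> \<le> real (card {..<m}) * ((rate * h)\<^sup>2 + C * (e + h) * (rate * h))"
        by (rule sum_bounded_above) (simp add: bound)
      also have "\<dots> = (real m * h) * (rate\<^sup>2 * h + rate * C * (e + h))"
        by (simp add: algebra_simps power2_eq_square)
      also have "\<dots> \<le> t * (rate\<^sup>2 * h + rate * C * (e + h))"
        using m h e C(1) rate_pos by (intro mult_right_mono) auto
      also have "\<dots> \<le> (t * rate\<^sup>2 + t * rate * C) * (e + h)"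
        using t e by (simp add: algebra_simps)
      finally show ?thesis .
    qed
    then show ?thesis
      using t C(1) rate_pos by (intro exI[of _ "t * rate\<^sup>2 + t * rate * C"]) auto
  qed
qed simp

text \<open>A vanishing integral forces the grid sum of every mesh h = t / (l + 1) to lie within K h
  of 0, which has probability O(h) by concentration.\<close>

lemma AE_path_integral_nonzero:
  fixes y :: "nat \<Rightarrow> real"
  assumes y: "\<exists>i\<le>k. y i \<noteq> y 0" and t: "0 < t"
  shows "AE \<omega> in M. N t \<omega> = k \<longrightarrow> integral {0..t} (\<lambda>s. y (N s \<omega>)) \<noteq> 0"
proof -
  obtain C where C: "0 \<le> C"
    "\<And>h m x e. 0 < h \<Longrightarrow> real m * h \<le> t \<Longrightarrow> 0 \<le> e \<Longrightarrow> prob (near h y m k x e) \<le> C * (e + h)"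
    using grid_concentration[OF y, of t] t by auto
  \<comment> \<open>The constant of the Riemann error on paths with
    \<open>N t \<omega> = k\<close>.\<close>
  define K where "K = (\<Sum>i\<le>k. 2 * norm (y i))"
  have K: "0 \<le> K" unfolding K_def by (intro sum_nonneg) auto
  \<comment> \<open>A measurable set enclosing the exceptional paths; intersecting over all meshes
    makes its probability zero.\<close>
  define A where "A = (\<Inter>l. near (t / real (Suc l)) y (Suc l) k 0 (K * (t / real (Suc l))))"
  have A: "A \<in> events"
    unfolding A_def using t by (intro sets.countable_INT) auto
  have "prob A \<le> C * (K + 1) * t / real (Suc l)" for l
  proof -
    let ?h = "t / real (Suc l)"
    have "prob A \<le> prob (near ?h y (Suc l) k 0 (K * ?h))"
      using t by (intro finite_measure_mono) (auto simp: A_def)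
    also have "\<dots> \<le> C * (K * ?h + ?h)"
      using t K by (intro C) auto
    also have "\<dots> = C * (K + 1) * t / real (Suc l)"
      by (simp add: algebra_simps add_divide_distrib)
    finally show ?thesis .
  qed
  moreover have "(\<lambda>l. C * (K + 1) * t / real (Suc l)) \<longlonglongrightarrow> 0"
    by real_asymp
  ultimately have "prob A \<le> 0"
    by (intro tendsto_lowerbound) auto
  then have "A \<in> null_sets M"
    using A by (auto simp: null_sets_def emeasure_eq_measure measure_le_0_iff)
  moreover have "{\<omega> \<in> space M. \<not> (N t \<omega> = k \<longrightarrow> integral {0..t} (\<lambda>s. y (N s \<omega>)) \<noteq> 0)} \<subseteq> A"
  proof
    fix \<omega> assume "\<omega> \<in> {\<omega> \<in> space M. \<not> (N t \<omega> = k \<longrightarrow> integral {0..t} (\<lambda>s. y (N s \<omega>)) \<noteq> 0)}"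
    then have \<omega>: "\<omega> \<in> space M" "integral {0..t} (\<lambda>s. y (N s \<omega>)) = 0" "N t \<omega> = k"
      by auto
    have "\<bar>grid_sum (t / real (Suc l)) y (Suc l) \<omega>\<bar> \<le> K * (t / real (Suc l))" for l
      using counting_path_integral(2)[OF N_mono[OF \<omega>(1)], of "t / real (Suc l)" "Suc l" y] t \<omega>
      by (simp add: grid_sum_def K_def mult_ac)
    then show "\<omega> \<in> A"
      using \<omega> by (auto simp: A_def near_def)
  qed
  ultimately show ?thesis by (rule AE_I')
qed

end

section \<open>The characteristic function of the parity integral\<close>

lemma discrete_gronwall:
  fixes e :: "nat \<Rightarrow> real"
  assumes "e 0 \<le> 0" "\<And>m. m < L \<Longrightarrow> e (Suc m) \<le> g * e m + \<delta>" "1 \<le> g" "0 \<le> \<delta>"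
  shows "m \<le> L \<Longrightarrow> e m \<le> real m * \<delta> * g ^ m"
proof (induction m)
  case (Suc m)
  have "g * e m \<le> g * (real m * \<delta> * g ^ m)"
    using Suc assms(3) by (intro mult_left_mono) auto
  then have "e (Suc m) \<le> g * (real m * \<delta> * g ^ m) + \<delta>"
    using assms(2)[of m] Suc.prems by linarith
  \<comment> \<open>Each term of the geometric sum is replaced by a common upper bound. This is
    harmless below, where the final power of g is \<open>exp (x * t)\<close>.\<close>
  moreover have "\<delta> \<le> \<delta> * g ^ Suc m"
    using mult_left_mono[OF one_le_power[OF assms(3), of "Suc m"] assms(4)] by simp
  ultimately show ?case by (simp add: algebra_simps)
qed (use assms in simp)

text \<open>
  With \<open>w\<^sup>2 = \<kappa>\<^sup>2 - a\<^sup>2\<close>, the pair of \<open>rotation_flow w \<kappa> a\<close> and \<open>rotation_flow w (- \<kappa>) a\<close> is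
  \<open>exp (z G)\<close> applied to the vector \<open>(1, 1)\<close>, where \<open>G = ((\<kappa>, ia), (ia, -\<kappa>))\<close> satisfies \<open>G\<^sup>2 = w\<^sup>2\<close>.
\<close>

definition rotation_flow :: "complex \<Rightarrow> real \<Rightarrow> real \<Rightarrow> complex \<Rightarrow> complex" where
  "rotation_flow w \<kappa> a z = cosh (w * z) + (of_real \<kappa> + \<i> * of_real a) * sinh (w * z) / w"

text \<open>First coordinate of the semigroup law exp((s + h) G) = (cosh(w h) + sinh(w h) / w G)
  exp(s G). The addition theorems produce a product of two sinh factors, which w^2 = \<kappa>^2 -
  a^2 converts into the entries of G^2.\<close>

lemma rotation_flow_add:
  assumes "w\<^sup>2 = of_real (\<kappa>\<^sup>2 - a\<^sup>2)" "w \<noteq> 0"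
  shows "rotation_flow w \<kappa> a (s + h) = cosh (w * h) * rotation_flow w \<kappa> a s
    + sinh (w * h) / w * (of_real \<kappa> * rotation_flow w \<kappa> a s + \<i> * of_real a * rotation_flow w (- \<kappa>) a s)"
proof -
  have w: "w * w = of_real \<kappa> * of_real \<kappa> - of_real a * of_real a"
    using assms(1) by (simp add: power2_eq_square)
  define S S' where "S = sinh (w * s) / w" and "S' = sinh (w * h) / w"
  have "sinh (w * s) = w * S" "sinh (w * h) = w * S'"
    using assms(2) by (simp_all add: S_def S'_def)
  moreover have "rotation_flow w \<kappa> a s = cosh (w * s) + (of_real \<kappa> + \<i> * of_real a) * S"
    "rotation_flow w (- \<kappa>) a s = cosh (w * s) + (- of_real \<kappa> + \<i> * of_real a) * S"
    by (simp_all add: rotation_flow_def S_def)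
  moreover have "rotation_flow w \<kappa> a (s + h) = cosh (w * s) * cosh (w * h) + w * S * (w * S')
      + (of_real \<kappa> + \<i> * of_real a) * (S * cosh (w * h) + cosh (w * s) * S')"
    using assms(2) by (simp add: rotation_flow_def S_def S'_def distrib_left cosh_add sinh_add field_simps)
  moreover have "w * S * (w * S') = (of_real \<kappa> * of_real \<kappa> - of_real a * of_real a) * S * S'"
    unfolding w[symmetric] by (simp add: mult_ac)
  ultimately show ?thesis
    unfolding S'_def[symmetric] by (simp only:) (simp add: algebra_simps)
qed

lemma tendsto_divide_null:
  fixes f :: "complex \<Rightarrow> complex"
  assumes "(f has_field_derivative 0) (at 0)" "f 0 = 0" "x \<longlonglongrightarrow> 0" "\<And>l::nat. x l \<noteq> 0"
  shows "(\<lambda>l. norm (f (of_real (x l))) / \<bar>x l\<bar>) \<longlonglongrightarrow> 0"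
proof -
  have "((\<lambda>z. f z / z) \<longlongrightarrow> 0) (at 0)"
    using assms(1,2) by (simp add: DERIV_def)
  moreover have "filterlim (\<lambda>l. of_real (x l) :: complex) (at 0) sequentially"
    using assms(3,4) by (auto simp: filterlim_at intro!: tendsto_eq_intros)
  ultimately have "(\<lambda>l. f (of_real (x l)) / of_real (x l)) \<longlonglongrightarrow> 0"
    by (rule filterlim_compose)
  then show ?thesis
    using tendsto_norm_zero by (force simp: norm_divide)
qed

text \<open>
  Entries of the difference between \<open>exp (z G)\<close> and the product of \<open>exp (z diag(\<kappa>, -\<kappa>))\<close> with the
  rotation generated by \<open>ia\<close>; they vanish to first order at 0, which is the consistency of the scheme.
\<close>

definition step_defect1 :: "complex \<Rightarrow> real \<Rightarrow> real \<Rightarrow> complex \<Rightarrow> complex" where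
  "step_defect1 w \<kappa> a z = cosh (w * z) + of_real \<kappa> * sinh (w * z) / w - exp (of_real \<kappa> * z) * cos (of_real a * z)"

definition step_defect2 :: "complex \<Rightarrow> real \<Rightarrow> real \<Rightarrow> complex \<Rightarrow> complex" where
  "step_defect2 w \<kappa> a z = \<i> * of_real a * sinh (w * z) / w - exp (of_real \<kappa> * z) * \<i> * sin (of_real a * z)"

lemma step_defect_deriv:
  assumes "w \<noteq> 0"
  shows "(step_defect1 w \<kappa> a has_field_derivative 0) (at 0)"
    and "(step_defect2 w \<kappa> a has_field_derivative 0) (at 0)"
  unfolding step_defect1_def[abs_def] step_defect2_def[abs_def]
  using assms by (auto intro!: derivative_eq_intros)

text \<open>The exact flow obeys the recursion of the scheme up to the two defects. The second
  coordinate is the same statement with - \<kappa> for \<kappa>.\<close>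

lemma rotation_flow_step:
  assumes "w\<^sup>2 = of_real (\<kappa>\<^sup>2 - a\<^sup>2)" "w \<noteq> 0"
  shows "rotation_flow w \<kappa> a (s + of_real h) =
    of_real (exp (\<kappa> * h)) * (of_real (cos (a * h)) * rotation_flow w \<kappa> a s
      + \<i> * of_real (sin (a * h)) * rotation_flow w (- \<kappa>) a s)
    + (step_defect1 w \<kappa> a (of_real h) * rotation_flow w \<kappa> a s
      + step_defect2 w \<kappa> a (of_real h) * rotation_flow w (- \<kappa>) a s)"
proof -
  have "exp (of_real \<kappa> * of_real h) = complex_of_real (exp (\<kappa> * h))"
    "cos (of_real a * of_real h) = complex_of_real (cos (a * h))"
    "sin (of_real a * of_real h) = complex_of_real (sin (a * h))"
    by (simp_all add: cos_of_real sin_of_real flip: of_real_mult exp_of_real)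
  then show ?thesis
    unfolding rotation_flow_add[OF assms] step_defect1_def step_defect2_def
    by (simp only:) (simp add: algebra_simps)
qed

text \<open>Consistency and stability give convergence: the local error is o(h), one step amplifies
  earlier errors by at most exp(x h), and there are t / h steps. P and Q are coupled, so both errors
  are estimated together.\<close>

lemma rotation_scheme_tendsto:
  fixes P Q :: "real \<Rightarrow> nat \<Rightarrow> complex"
  assumes w: "w\<^sup>2 = of_real (\<kappa>\<^sup>2 - a\<^sup>2)" "w \<noteq> 0" and t: "0 < t"
    and P0: "\<And>h. 0 < h \<Longrightarrow> P h 0 = 1" and Q0: "\<And>h. 0 < h \<Longrightarrow> Q h 0 = 1"
    and P: "\<And>h m. 0 < h \<Longrightarrow> P h (Suc m) =
      of_real (exp (\<kappa> * h)) * (of_real (cos (a * h)) * P h m + \<i> * of_real (sin (a * h)) * Q h m)"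
    and Q: "\<And>h m. 0 < h \<Longrightarrow> Q h (Suc m) =
      of_real (exp (- \<kappa> * h)) * (of_real (cos (a * h)) * Q h m + \<i> * of_real (sin (a * h)) * P h m)"
  shows "(\<lambda>l. P (t / real (Suc l)) (Suc l)) \<longlonglongrightarrow> rotation_flow w \<kappa> a (of_real t)"
proof -
  define u v where "u = (\<lambda>s. rotation_flow w \<kappa> a (of_real s))"
    and "v = (\<lambda>s. rotation_flow w (- \<kappa>) a (of_real s))"
  have w': "w\<^sup>2 = of_real ((- \<kappa>)\<^sup>2 - a\<^sup>2)" using w(1) by simp
  define d where "d h = norm (step_defect1 w \<kappa> a (of_real h)) + norm (step_defect2 w \<kappa> a (of_real h))
    + norm (step_defect1 w (- \<kappa>) a (of_real h)) + norm (step_defect2 w (- \<kappa>) a (of_real h))" for h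
  have d_nonneg: "0 \<le> d h" for h unfolding d_def by simp
  have "continuous_on {0..t} (\<lambda>s. norm (u s) + norm (v s))"
    unfolding u_def v_def rotation_flow_def using w(2) by (intro continuous_intros) auto
  then have "bounded ((\<lambda>s. norm (u s) + norm (v s)) ` {0..t})"
    by (intro compact_imp_bounded compact_continuous_image) auto
  \<comment> \<open>K bounds the exact solution on the time interval; it multiplies the defects in
    the local error.\<close>
  then obtain K where K: "norm (u s) + norm (v s) \<le> K" if "s \<in> {0..t}" for s
    unfolding bounded_iff by fastforce
  have K': "norm (u s) \<le> K" "norm (v s) \<le> K" if "s \<in> {0..t}" for s
    using K[OF that] norm_ge_zero[of "u s"] norm_ge_zero[of "v s"] by linarith+
  have "0 \<le> K" using order_trans[OF norm_ge_zero K'(1)[of 0]] t by simp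
  \<comment> \<open>Growth rate of the scheme in the sum norm of the pair: the diagonal factor costs
    at most exp(|\<kappa>| h), the rotation at most |cos(a h)| + |sin(a h)| \<le> 1 + |a| h \<le>
    exp(|a| h).\<close>
  define x where "x = \<bar>\<kappa>\<bar> + \<bar>a\<bar>"
  have err: "norm (P h L - u (real L * h)) \<le> real L * (K * d h) * exp (x * h) ^ L"
    if h: "0 < h" and L: "real L * h \<le> t" for h L
  proof -
    define e where "e m = norm (P h m - u (real m * h)) + norm (Q h m - v (real m * h))" for m
    have "e m \<le> real m * (K * d h) * exp (x * h) ^ m" if "m \<le> L" for m
    proof (rule discrete_gronwall[OF _ _ _ _ that])
      show "e 0 \<le> 0" using h by (simp add: e_def P0 Q0 u_def v_def rotation_flow_def)
      show "1 \<le> exp (x * h)" using h by (simp add: x_def)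
      show "0 \<le> K * d h" using \<open>0 \<le> K\<close> d_nonneg by simp
      fix m assume "m < L"
      let ?s = "real m * h"
      have "?s \<in> {0..t}" using order_trans[OF mult_right_mono L] \<open>m < L\<close> h by auto
      note Ks = K'[OF this]
      define p q where "p = P h m - u ?s" and "q = Q h m - v ?s"
      have s: "of_real (real (Suc m) * h) = of_real ?s + (of_real h :: complex)"
        by (simp add: algebra_simps)
      define c1 c2 where "c1 = complex_of_real (cos (a * h))" and "c2 = \<i> * complex_of_real (sin (a * h))"
      have c: "norm c1 + norm c2 \<le> exp (\<bar>a\<bar> * h)"
      proof -
        have "norm c1 + norm c2 \<le> 1 + \<bar>a * h\<bar>"
          unfolding c1_def c2_def using add_mono[OF abs_cos_le_one[of "a * h"] abs_sin_x_le_abs_x[of "a * h"]]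
          by (simp add: norm_mult)
        also have "\<dots> \<le> exp (\<bar>a\<bar> * h)"
          using exp_ge_add_one_self[of "\<bar>a\<bar> * h"] h by (simp add: abs_mult)
        finally show ?thesis .
      qed
      define D1 D2 D3 D4 where "D1 = step_defect1 w \<kappa> a (of_real h)" and "D2 = step_defect2 w \<kappa> a (of_real h)"
        and "D3 = step_defect1 w (- \<kappa>) a (of_real h)" and "D4 = step_defect2 w (- \<kappa>) a (of_real h)"
      have pe: "P h (Suc m) - u (real (Suc m) * h) =
          of_real (exp (\<kappa> * h)) * (c1 * p + c2 * q) - (D1 * u ?s + D2 * v ?s)"
        unfolding P[OF h] u_def v_def s rotation_flow_step[OF w] p_def q_def D1_def D2_def c1_def c2_def
        by (simp add: algebra_simps)
      have qe: "Q h (Suc m) - v (real (Suc m) * h) =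
          of_real (exp (- \<kappa> * h)) * (c1 * q + c2 * p) - (D3 * v ?s + D4 * u ?s)"
        unfolding Q[OF h] u_def v_def s rotation_flow_step[OF w' w(2)] p_def q_def D3_def D4_def c1_def c2_def
        by (simp add: algebra_simps)
      have main: "norm (of_real (exp (k * h)) * (c1 * y + c2 * z)) \<le> exp (\<bar>\<kappa>\<bar> * h) * (norm c1 * norm y + norm c2 * norm z)"
        if "k = \<kappa> \<or> k = - \<kappa>" for k :: real and y z
      proof -
        have "k * h \<le> \<bar>\<kappa>\<bar> * h" using that h by (intro mult_right_mono) auto
        moreover have "norm (c1 * y + c2 * z) \<le> norm c1 * norm y + norm c2 * norm z"
          by (metis norm_mult norm_triangle_ineq)
        ultimately show ?thesis unfolding norm_mult by (intro mult_mono) auto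
      qed
      have rest: "norm (A * y + B * z) \<le> K * (norm A + norm B)" if "norm y \<le> K" "norm z \<le> K" for A B y z :: complex
      proof -
        have "norm (A * y + B * z) \<le> norm A * norm y + norm B * norm z"
          by (metis norm_mult norm_triangle_ineq)
        also have "\<dots> \<le> norm A * K + norm B * K"
          using that by (intro add_mono mult_left_mono) auto
        finally show ?thesis by (simp add: algebra_simps)
      qed
      have "e (Suc m) \<le> exp (\<bar>\<kappa>\<bar> * h) * (norm c1 * norm p + norm c2 * norm q) + K * (norm D1 + norm D2)
          + (exp (\<bar>\<kappa>\<bar> * h) * (norm c1 * norm q + norm c2 * norm p) + K * (norm D3 + norm D4))"
        unfolding e_def pe qe
        by (intro add_mono order_trans[OF norm_triangle_ineq4] main rest Ks) auto
      also have "\<dots> = exp (\<bar>\<kappa>\<bar> * h) * (norm c1 + norm c2) * e m + K * d h"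
        by (simp add: e_def p_def q_def d_def D1_def D2_def D3_def D4_def algebra_simps)
      also have "\<dots> \<le> exp (\<bar>\<kappa>\<bar> * h) * exp (\<bar>a\<bar> * h) * e m + K * d h"
        using c by (intro add_right_mono mult_right_mono mult_left_mono) (auto simp: e_def)
      also have "exp (\<bar>\<kappa>\<bar> * h) * exp (\<bar>a\<bar> * h) = exp (x * h)"
        by (simp add: x_def distrib_right exp_add)
      finally show "e (Suc m) \<le> exp (x * h) * e m + K * d h" .
    qed
    from this[of L] show ?thesis
      unfolding e_def using norm_ge_zero[of "Q h L - v (real L * h)"] by linarith
  qed
  define hh where "hh l = t / real (Suc l)" for l
  have hh: "0 < hh l" "hh l \<noteq> 0" "real (Suc l) * hh l = t" for l
    using t by (auto simp: hh_def simp del: of_nat_Suc)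
  have hh0: "hh \<longlonglongrightarrow> 0" unfolding hh_def by real_asymp
  \<comment> \<open>All four defects vanish at 0 together with their derivatives, so d h = o(h);
    dividing by h accounts for the number of steps.\<close>
  have "(\<lambda>l. d (hh l) / \<bar>hh l\<bar>) \<longlonglongrightarrow> 0 + 0 + 0 + 0"
    unfolding d_def add_divide_distrib
    by (intro tendsto_add tendsto_divide_null step_defect_deriv w(2) hh0 hh)
       (simp_all add: step_defect1_def step_defect2_def)
  then have lim: "(\<lambda>l. t * K * exp (x * t) * (d (hh l) / \<bar>hh l\<bar>)) \<longlonglongrightarrow> 0"
    by (intro tendsto_mult_right_zero) simp
  have "norm (P (hh l) (Suc l) - u t) \<le> t * K * exp (x * t) * (d (hh l) / \<bar>hh l\<bar>)" for l
  proof -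
    have "norm (P (hh l) (Suc l) - u t) \<le> real (Suc l) * (K * d (hh l)) * exp (x * hh l) ^ Suc l"
      using err[of "hh l" "Suc l"] unfolding hh(3) by (simp add: hh)
    also have "exp (x * hh l) ^ Suc l = exp (x * t)"
      unfolding exp_of_nat_mult[symmetric] hh(3)[of l, symmetric] by (simp only: mult_ac)
    also have "real (Suc l) = t / hh l" using hh[of l] by (metis nonzero_eq_divide_eq)
    finally show ?thesis using hh[of l] by (simp add: mult_ac)
  qed
  then have "(\<lambda>l. P (hh l) (Suc l) - u t) \<longlonglongrightarrow> 0"
    using lim by (rule Lim_null_comparison[OF always_eventually[OF allI]])
  then show ?thesis
    unfolding hh_def u_def by (simp add: LIM_zero_iff)
qed


section \<open>Discretised characteristic functions and their limit\<close>

context poisson_clock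
begin

abbreviation parity_sum :: "real \<Rightarrow> nat \<Rightarrow> 'a \<Rightarrow> real" where
  "parity_sum h \<equiv> grid_sum h (\<lambda>n. (- 1) ^ n)"

definition grid_char :: "real \<Rightarrow> real \<Rightarrow> real \<Rightarrow> nat \<Rightarrow> complex" where
  "grid_char a z h m = (LINT \<omega>|M. of_real (z ^ N (real m * h) \<omega>) * exp (\<i> * of_real (a * parity_sum h m \<omega>)))"

lemma integrable_grid_char:
  assumes "0 < h" "\<bar>z\<bar> \<le> 1"
  shows "integrable M (\<lambda>\<omega>. of_real (z ^ N (real m * h) \<omega>) * exp (\<i> * of_real (a * parity_sum h m \<omega>)) :: complex)"
proof (rule integrable_const_bound[where B = 1])
  show "AE \<omega> in M. norm (of_real (z ^ N (real m * h) \<omega>) * exp (\<i> * of_real (a * parity_sum h m \<omega>)) :: complex) \<le> 1"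
    using assms(2) by (simp add: norm_mult norm_power power_abs power_le_one)
  have [measurable]: "N (real m * h) \<in> measurable M (count_space UNIV)"
    "parity_sum h m \<in> borel_measurable M"
    using assms(1) by auto
  show "(\<lambda>\<omega>. of_real (z ^ N (real m * h) \<omega>) * exp (\<i> * of_real (a * parity_sum h m \<omega>)) :: complex) \<in> borel_measurable M"
    by measurable
qed

lemma grid_char_0: "grid_char a z h 0 = 1"
proof -
  have "grid_char a z h 0 = (LINT \<omega>|M. (1 :: complex))"
    unfolding grid_char_def by (intro Bochner_Integration.integral_cong) (simp_all add: N_0 grid_sum_def)
  then show ?thesis by (simp add: prob_space)
qed

text \<open>The new cell contributes the phase exp(i a h (-1)^n) = cos(a h) + i (-1)^n sin(a h),
  where n is the count at its left end. The sign is absorbed by (-1)^n z^n = (-z)^n, which couples z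
  with - z. The new increment is independent of the past and enters only through its generating
  function.\<close>

lemma grid_char_Suc:
  assumes h: "0 < h" and z: "\<bar>z\<bar> \<le> 1"
  shows "grid_char a z h (Suc m) = of_real (exp (- (rate * h) * (1 - z))) *
    (of_real (cos (a * h)) * grid_char a z h m + \<i> * of_real (sin (a * h)) * grid_char a (- z) h m)"
proof -
  define f where "f w \<omega> = (of_real (w ^ N (real m * h) \<omega>) * exp (\<i> * of_real (a * parity_sum h m \<omega>)) :: complex)" for w \<omega>
  define X where "X \<omega> = of_real (cos (a * h)) * f z \<omega> + \<i> * of_real (sin (a * h)) * f (- z) \<omega>" for \<omega>
  define Y where "Y \<omega> = complex_of_real (z ^ incr h m \<omega>)" for \<omega>
  have int_f: "integrable M (f w)" if "w = z \<or> w = - z" for w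
    unfolding f_def using that z by (intro integrable_grid_char[OF h]) auto
  have int_X: "integrable M X"
    unfolding X_def by (intro Bochner_Integration.integrable_add integrable_mult_right int_f) auto
  have int_Y: "integrable M Y"
  proof (rule integrable_const_bound[where B = 1])
    show "AE \<omega> in M. norm (Y \<omega>) \<le> 1"
      using z by (simp add: Y_def norm_power power_le_one)
    have [measurable]: "incr h m \<in> measurable M (count_space UNIV)"
      using h by simp
    show "Y \<in> borel_measurable M"
      unfolding Y_def by measurable
  qed
  let ?F = "\<lambda>n :: nat \<Rightarrow> nat. let e = exp (\<i> * of_real (a * (h * (\<Sum>i<m. (- 1) ^ n i)))) in
    of_real (cos (a * h)) * (of_real (z ^ n m) * e) + \<i> * of_real (sin (a * h)) * (of_real ((- z) ^ n m) * e)"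
  have "indep_var borel (\<lambda>\<omega>. ?F (\<lambda>i. N (real i * h) \<omega>)) borel (\<lambda>\<omega>. complex_of_real (z ^ incr h m \<omega>))"
    by (rule indep_past_incr[OF h, where F = ?F and G = "\<lambda>d. complex_of_real (z ^ d)"]) simp_all
  then have "indep_var borel X borel Y"
    by (simp add: X_def[abs_def] Y_def[abs_def] f_def grid_sum_def Let_def)
  then have prod: "(LINT \<omega>|M. X \<omega> * Y \<omega>) = (LINT \<omega>|M. X \<omega>) * (LINT \<omega>|M. Y \<omega>)"
    by (rule indep_var_lebesgue_integral[OF _ int_X int_Y])
  have X: "(LINT \<omega>|M. X \<omega>) = of_real (cos (a * h)) * grid_char a z h m
      + \<i> * of_real (sin (a * h)) * grid_char a (- z) h m"
    unfolding X_def grid_char_def f_def[symmetric]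
    by (subst Bochner_Integration.integral_add) (auto intro!: integrable_mult_right int_f)
  have Y: "(LINT \<omega>|M. Y \<omega>) = of_real (exp (- (rate * h) * (1 - z)))"
    unfolding Y_def integral_complex_of_real expectation_power_incr[OF h z] ..
  have split: "exp (\<i> * of_real (a * (h * (- 1) ^ n))) * of_real (z ^ n) =
      of_real (cos (a * h)) * of_real (z ^ n) + \<i> * of_real (sin (a * h)) * complex_of_real ((- z) ^ n)" for n
  proof -
    have "cis (a * (h * (- 1) ^ n)) = of_real (cos (a * h)) + \<i> * of_real ((- 1) ^ n * sin (a * h))"
      by (cases "even n") (simp_all add: complex_eq_iff)
    then show ?thesis
      unfolding cis_conv_exp by (simp add: power_minus[of z] power_minus[of "complex_of_real z"] algebra_simps)
  qed
  have "grid_char a z h (Suc m) = (LINT \<omega>|M. X \<omega> * Y \<omega>)"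
    unfolding grid_char_def
  proof (rule Bochner_Integration.integral_cong[OF refl])
    fix \<omega> assume \<omega>: "\<omega> \<in> space M"
    let ?n = "N (real m * h) \<omega>" and ?e = "exp (\<i> * of_real (a * parity_sum h m \<omega>))"
    have N: "N (real (Suc m) * h) \<omega> = ?n + incr h m \<omega>"
      using \<omega> h by (intro N_Suc_grid) auto
    have e: "exp (\<i> * of_real (a * parity_sum h (Suc m) \<omega>)) = ?e * exp (\<i> * of_real (a * (h * (- 1) ^ ?n)))"
      by (simp add: grid_sum_Suc distrib_left exp_add)
    have X: "X \<omega> = ?e * (exp (\<i> * of_real (a * (h * (- 1) ^ ?n))) * of_real (z ^ ?n))"
      unfolding split X_def f_def by (simp add: algebra_simps)
    show "of_real (z ^ N (real (Suc m) * h) \<omega>) * exp (\<i> * of_real (a * parity_sum h (Suc m) \<omega>)) = X \<omega> * Y \<omega>"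
      unfolding N e X Y_def by (simp add: power_add mult_ac)
  qed
  then show ?thesis unfolding prod X Y by (simp add: mult.commute)
qed

lemma grid_sum_tendsto:
  assumes "\<omega> \<in> space M" "0 < t"
  shows "(\<lambda>l. grid_sum (t / real (Suc l)) y (Suc l) \<omega>) \<longlonglongrightarrow> integral {0..t} (\<lambda>s. y (N s \<omega>))"
proof -
  define K where "K = (\<Sum>k\<le>N t \<omega>. 2 * norm (y k))"
  have "norm (grid_sum (t / real (Suc l)) y (Suc l) \<omega> - integral {0..t} (\<lambda>s. y (N s \<omega>))) \<le> (t / real (Suc l)) * K" for l
    using counting_path_integral(2)[OF N_mono[OF assms(1)], of "t / real (Suc l)" "Suc l" y] assms(2)
    by (simp add: grid_sum_def K_def norm_minus_commute abs_minus_commute)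
  moreover have "(\<lambda>l. t / real (Suc l) * K) \<longlonglongrightarrow> 0"
    by real_asymp
  ultimately have "(\<lambda>l. grid_sum (t / real (Suc l)) y (Suc l) \<omega> - integral {0..t} (\<lambda>s. y (N s \<omega>))) \<longlonglongrightarrow> 0"
    by (rule Lim_null_comparison[OF always_eventually[OF allI]])
  then show ?thesis by (simp add: LIM_zero_iff)
qed

text \<open>Displacement of the one-dimensional telegraph process of unit speed, started to the
  right and reversed at each Poisson event.\<close>

definition parity_integral :: "real \<Rightarrow> 'a \<Rightarrow> real" where
  "parity_integral t \<omega> = integral {0..t} (\<lambda>s. (- 1) ^ N s \<omega>)"

lemma parity_sum_tendsto:
  assumes "\<omega> \<in> space M" "0 < t"
  shows "(\<lambda>l. parity_sum (t / real (Suc l)) (Suc l) \<omega>) \<longlonglongrightarrow> parity_integral t \<omega>"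
  unfolding parity_integral_def by (rule grid_sum_tendsto[OF assms])

lemma measurable_parity_integral [measurable]:
  assumes "0 < t"
  shows "parity_integral t \<in> borel_measurable M"
  by (rule borel_measurable_LIMSEQ_real[OF parity_sum_tendsto]) (use assms in auto)

text \<open>The grid characteristic functions converge in two ways, through the scheme to the flow
  and by dominated convergence to the expectation; the limits coincide.\<close>

lemma telegraph_char:
  assumes w: "w\<^sup>2 = of_real ((rate * r)\<^sup>2 - a\<^sup>2)" "w \<noteq> 0" and r: "\<bar>r\<bar> \<le> 1" and t: "0 < t"
  shows "(LINT \<omega>|M. of_real (r ^ N t \<omega>) * exp (\<i> * of_real (a * parity_integral t \<omega>))) =
    of_real (exp (- rate * t)) * rotation_flow w (rate * r) a (of_real t)"
proof -
  \<comment> \<open>The prefactor cancels the part exp(- rate h) of the generating function of an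
    increment, leaving the factor exp(rate z h) of the scheme.\<close>
  define P where "P z h m = of_real (exp (rate * h * real m)) * grid_char a z h m" for z h m
  have step: "P z h (Suc m) = of_real (exp (rate * z * h)) *
      (of_real (cos (a * h)) * P z h m + \<i> * of_real (sin (a * h)) * P (- z) h m)"
    if "0 < h" "\<bar>z\<bar> \<le> 1" for z h m
  proof -
    have "exp (rate * h * real (Suc m)) * exp (- (rate * h) * (1 - z)) = exp (rate * z * h) * exp (rate * h * real m)"
      unfolding exp_add[symmetric] by (simp add: algebra_simps)
    then have "complex_of_real (exp (rate * h * real (Suc m))) * of_real (exp (- (rate * h) * (1 - z))) =
        of_real (exp (rate * z * h)) * of_real (exp (rate * h * real m))"
      unfolding of_real_mult[symmetric] by (rule arg_cong)
    then show ?thesis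
      unfolding P_def grid_char_Suc[OF that] mult.assoc[symmetric]
      by (simp only:) (simp add: algebra_simps)
  qed
  have "(\<lambda>l. P r (t / real (Suc l)) (Suc l)) \<longlonglongrightarrow> rotation_flow w (rate * r) a (of_real t)"
  proof (rule rotation_scheme_tendsto[OF w t, where Q = "P (- r)"])
    fix h :: real and m assume h: "0 < h"
    show "P r h 0 = 1" "P (- r) h 0 = 1"
      by (simp_all add: P_def grid_char_0)
    show "P r h (Suc m) = of_real (exp (rate * r * h)) *
      (of_real (cos (a * h)) * P r h m + \<i> * of_real (sin (a * h)) * P (- r) h m)"
      using step[OF h r] .
    show "P (- r) h (Suc m) = of_real (exp (- (rate * r) * h)) *
      (of_real (cos (a * h)) * P (- r) h m + \<i> * of_real (sin (a * h)) * P r h m)"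
      using step[OF h, of "- r"] r by simp
  qed
  then have "(\<lambda>l. of_real (exp (- rate * t)) * P r (t / real (Suc l)) (Suc l)) \<longlonglongrightarrow>
      of_real (exp (- rate * t)) * rotation_flow w (rate * r) a (of_real t)"
    by (rule tendsto_mult_left)
  moreover have "of_real (exp (- rate * t)) * P r (t / real (Suc l)) (Suc l) = grid_char a r (t / real (Suc l)) (Suc l)" for l
  proof -
    have "exp (- rate * t) * exp (rate * (t / real (Suc l)) * real (Suc l)) = 1"
      by (simp add: exp_add[symmetric] del: of_nat_Suc)
    then show ?thesis
      unfolding P_def mult.assoc[symmetric] of_real_mult[symmetric] by simp
  qed
  ultimately have lim1: "(\<lambda>l. grid_char a r (t / real (Suc l)) (Suc l)) \<longlonglongrightarrow>
      of_real (exp (- rate * t)) * rotation_flow w (rate * r) a (of_real t)"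
    by (simp only:)
  \<comment> \<open>The last grid point is t itself, so the weight is constant in l and only the
    phase converges; |r| \<le> 1 supplies the dominating function 1.\<close>
  have "(\<lambda>l. grid_char a r (t / real (Suc l)) (Suc l)) \<longlonglongrightarrow>
      (LINT \<omega>|M. of_real (r ^ N t \<omega>) * exp (\<i> * of_real (a * parity_integral t \<omega>)))"
    unfolding grid_char_def
  proof (rule integral_dominated_convergence[where w = "\<lambda>_. 1"])
    fix l :: nat
    show "(\<lambda>\<omega>. of_real (r ^ N (real (Suc l) * (t / real (Suc l))) \<omega>) *
        exp (\<i> * of_real (a * parity_sum (t / real (Suc l)) (Suc l) \<omega>)) :: complex) \<in> borel_measurable M"
    proof -
      have [measurable]: "N (real (Suc l) * (t / real (Suc l))) \<in> measurable M (count_space UNIV)"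
        "parity_sum (t / real (Suc l)) (Suc l) \<in> borel_measurable M"
        using t by (auto simp del: of_nat_Suc)
      show ?thesis by measurable
    qed
    show "AE \<omega> in M. norm (of_real (r ^ N (real (Suc l) * (t / real (Suc l))) \<omega>) *
        exp (\<i> * of_real (a * parity_sum (t / real (Suc l)) (Suc l) \<omega>)) :: complex) \<le> 1"
      using r by (simp add: norm_mult norm_power power_le_one del: of_nat_Suc)
  next
    have "parity_integral t \<in> borel_measurable M"
      using t by simp
    moreover have "N t \<in> measurable M (count_space UNIV)"
      using t by simp
    ultimately show "(\<lambda>\<omega>. of_real (r ^ N t \<omega>) * exp (\<i> * of_real (a * parity_integral t \<omega>)) :: complex) \<in> borel_measurable M"
      by measurable
    have "(\<lambda>l. of_real (r ^ N (real (Suc l) * (t / real (Suc l))) \<omega>) *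
        exp (\<i> * of_real (a * parity_sum (t / real (Suc l)) (Suc l) \<omega>)))
      \<longlonglongrightarrow> of_real (r ^ N t \<omega>) * exp (\<i> * complex_of_real (a * parity_integral t \<omega>))"
      if "\<omega> \<in> space M" for \<omega>
      by (auto intro!: tendsto_intros parity_sum_tendsto that t simp del: of_nat_Suc)
    then show "AE \<omega> in M. (\<lambda>l. of_real (r ^ N (real (Suc l) * (t / real (Suc l))) \<omega>) *
        exp (\<i> * of_real (a * parity_sum (t / real (Suc l)) (Suc l) \<omega>)))
      \<longlonglongrightarrow> of_real (r ^ N t \<omega>) * exp (\<i> * complex_of_real (a * parity_integral t \<omega>))"
      by (intro AE_I2)
  qed simp
  then show ?thesis using lim1 by (rule LIMSEQ_unique)
qed

end

section \<open>Continuity in the argument and decomposition by the number of events\<close>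

context poisson_clock
begin

definition parity_char :: "real \<Rightarrow> real \<Rightarrow> real \<Rightarrow> complex" where
  "parity_char t r a = (LINT \<omega>|M. of_real (r ^ N t \<omega>) * exp (\<i> * of_real (a * parity_integral t \<omega>)))"

lemma measurable_parity_char [measurable]:
  assumes "0 < t"
  shows "(\<lambda>\<omega>. of_real (r ^ N t \<omega>) * exp (\<i> * of_real (a * parity_integral t \<omega>)) :: complex) \<in> borel_measurable M"
proof -
  have [measurable]: "N t \<in> measurable M (count_space UNIV)" "parity_integral t \<in> borel_measurable M"
    using assms by auto
  show ?thesis by measurable
qed

text \<open>Serves the arguments at which the root vanishes, where the closed formula is reached
  only as a limit.\<close>

lemma isCont_parity_char:
  assumes "0 < t" "\<bar>r\<bar> \<le> 1"
  shows "isCont (parity_char t r) a"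
  unfolding continuous_at_sequentially o_def parity_char_def
proof (intro allI impI)
  fix x :: "nat \<Rightarrow> real" assume x: "x \<longlonglongrightarrow> a"
  show "(\<lambda>l. LINT \<omega>|M. of_real (r ^ N t \<omega>) * exp (\<i> * of_real (x l * parity_integral t \<omega>)) :: complex)
    \<longlonglongrightarrow> (LINT \<omega>|M. of_real (r ^ N t \<omega>) * exp (\<i> * of_real (a * parity_integral t \<omega>)))"
  proof (rule integral_dominated_convergence[where w = "\<lambda>_. 1"])
    show "AE \<omega> in M. norm (of_real (r ^ N t \<omega>) * exp (\<i> * of_real (x l * parity_integral t \<omega>)) :: complex) \<le> 1" for l
      using assms by (simp add: norm_mult norm_power power_le_one)
    show "AE \<omega> in M. (\<lambda>l. of_real (r ^ N t \<omega>) * exp (\<i> * of_real (x l * parity_integral t \<omega>)))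
      \<longlonglongrightarrow> of_real (r ^ N t \<omega>) * exp (\<i> * complex_of_real (a * parity_integral t \<omega>))"
      by (intro AE_I2 tendsto_intros x)
  qed (use assms in \<open>auto intro!: measurable_parity_char\<close>)
qed

text \<open>On \<open>N t \<omega> = n\<close> the number of turns is deterministic, so the random
  product over turns becomes a fixed finite one, to which independence applies.\<close>

lemma integral_eq_by_count:
  fixes f g :: "'a \<Rightarrow> complex"
  assumes t: "0 \<le> t" and f: "integrable M f" and g: "integrable M g"
    and eq: "\<And>n. (LINT \<omega>:{\<omega>\<in>space M. N t \<omega> = n}|M. f \<omega>) = (LINT \<omega>:{\<omega>\<in>space M. N t \<omega> = n}|M. g \<omega>)"
  shows "(LINT \<omega>|M. f \<omega>) = (LINT \<omega>|M. g \<omega>)"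
proof -
  define A where "A n = {\<omega>\<in>space M. N t \<omega> = n}" for n
  have A: "A n \<in> events" for n
    using measurable_sets[OF measurable_N[OF t], of "{n}"] by (simp add: A_def vimage_def Int_def conj_commute)
  have UN: "(\<Union>n. A n) = space M" by (auto simp: A_def)
  have split: "(LINT \<omega>|M. k \<omega>) = (\<Sum>n. LINT \<omega>:A n|M. k \<omega>)" if "integrable M k" for k :: "'a \<Rightarrow> complex"
  proof -
    have "(LINT \<omega>|M. k \<omega>) = (LINT \<omega>:(\<Union>n. A n)|M. k \<omega>)"
      using that by (simp add: UN set_integral_space)
    also have "\<dots> = (\<Sum>n. LINT \<omega>:A n|M. k \<omega>)"
    proof (rule lebesgue_integral_countable_add[OF A])
      show "set_integrable M (\<Union>n. A n) k"
        using that unfolding UN set_integrable_def by (rule integrable_mult_indicator[rotated]) auto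
    qed (auto simp: A_def)
    finally show ?thesis .
  qed
  show ?thesis
    unfolding split[OF f] split[OF g] using eq by (simp add: A_def)
qed

end

section \<open>The orthogonal motion\<close>

lemma snd_dir_eq_0_iff: "snd (dir j) = 0 \<longleftrightarrow> even j"
proof -
  have "pi * real_of_int j / 2 = real_of_int i * pi \<longleftrightarrow> j = 2 * i" for i
  proof -
    have "pi * real_of_int j / 2 = real_of_int i * pi \<longleftrightarrow> real_of_int j = real_of_int (2 * i)"
      by (simp add: field_simps)
    then show ?thesis by linarith
  qed
  then show ?thesis
    unfolding dir_def snd_conv sin_zero_iff_int2 by (auto simp: dvd_def)
qed

lemma fst_dir_add_even: "fst (dir (j + 2 * int n)) = (- 1) ^ n * fst (dir j)"
proof (induction n)
  case (Suc n)
  have "pi * real_of_int (j + 2 * int (Suc n)) / 2 = pi * real_of_int (j + 2 * int n) / 2 + pi"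
    by (simp add: field_simps)
  then have "fst (dir (j + 2 * int (Suc n))) = - fst (dir (j + 2 * int n))"
    unfolding dir_def by (simp only: fst_conv cos_add) simp
  with Suc show ?case by simp
qed simp

sublocale orthogonal_motion \<subseteq> poisson_clock M rate N
  by unfold_locales (rule poisson)

context orthogonal_motion
begin

text \<open>Indexed by the number of events instead of time: the direction is then a function of the
  counting path, as the Riemann sum estimates require.\<close>

definition heading :: "'a \<Rightarrow> nat \<Rightarrow> int" where
  "heading \<omega> i = J \<omega> + (\<Sum>k<i. \<xi> k \<omega>)"

lemma measurable_heading [measurable]: "(\<lambda>\<omega>. heading \<omega> i) \<in> measurable M (count_space UNIV)"
proof (induction i)
  case 0
  then show ?case using J_measurable by (simp add: heading_def)
next
  case (Suc i)
  have "(\<lambda>\<omega>. heading \<omega> i + \<xi> i \<omega>) \<in> measurable M (count_space UNIV)"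
    by (rule measurable_compose_countable[OF _ Suc.IH])
       (rule measurable_compose[OF turn_measurable], simp)
  then show ?case by (simp add: heading_def add.assoc)
qed

lemma position_eq:
  assumes "\<omega> \<in> space M"
  shows "fst (position c N J \<xi> t \<omega>) = c * integral {0..t} (\<lambda>s. fst (dir (heading \<omega> (N s \<omega>))))"
    and "snd (position c N J \<xi> t \<omega>) = c * integral {0..t} (\<lambda>s. snd (dir (heading \<omega> (N s \<omega>))))"
proof -
  have int: "(\<lambda>s. dir (heading \<omega> (N s \<omega>))) integrable_on {0..t}"
    using counting_path_integral(1)[OF N_mono[OF assms], of "\<lambda>n. dir (heading \<omega> n)" t] .
  show "fst (position c N J \<xi> t \<omega>) = c * integral {0..t} (\<lambda>s. fst (dir (heading \<omega> (N s \<omega>))))"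
    using integral_linear[OF int bounded_linear_fst]
    by (simp add: position_def direction_def heading_def[symmetric] o_def)
  show "snd (position c N J \<xi> t \<omega>) = c * integral {0..t} (\<lambda>s. snd (dir (heading \<omega> (N s \<omega>))))"
    using integral_linear[OF int bounded_linear_snd]
    by (simp add: position_def direction_def heading_def[symmetric] o_def)
qed

lemma measurable_path_integral:
  fixes f :: "int \<Rightarrow> real"
  assumes "0 < t"
  shows "(\<lambda>\<omega>. integral {0..t} (\<lambda>s. f (heading \<omega> (N s \<omega>)))) \<in> borel_measurable M"
proof (rule borel_measurable_LIMSEQ_real)
  show "(\<lambda>l. grid_sum (t / real (Suc l)) (\<lambda>n. f (heading \<omega> n)) (Suc l) \<omega>)
      \<longlonglongrightarrow> integral {0..t} (\<lambda>s. f (heading \<omega> (N s \<omega>)))" if "\<omega> \<in> space M" for \<omega>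
    by (rule grid_sum_tendsto[OF that assms])
  \<comment> \<open>The summed sequence depends on \<omega> here, so measurability of each term
    comes from composition over the countably many values of N.\<close>
  have "(\<lambda>\<omega>. f (heading \<omega> (N s \<omega>))) \<in> borel_measurable M" if "0 \<le> s" for s
    by (rule measurable_compose_countable[OF _ measurable_N[OF that]])
       (rule measurable_compose[OF measurable_heading], simp)
  then show "(\<lambda>\<omega>. grid_sum (t / real (Suc l)) (\<lambda>n. f (heading \<omega> n)) (Suc l) \<omega>) \<in> borel_measurable M" for l
    unfolding grid_sum_def using assms
    by (intro borel_measurable_times borel_measurable_sum borel_measurable_const) auto
qed

lemma measurable_position:
  assumes "0 < t"
  shows "(\<lambda>\<omega>. fst (position c N J \<xi> t \<omega>)) \<in> borel_measurable M"
    and "(\<lambda>\<omega>. snd (position c N J \<xi> t \<omega>)) \<in> borel_measurable M"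
proof -
  have "(\<lambda>\<omega>. c * integral {0..t} (\<lambda>s. f (heading \<omega> (N s \<omega>)))) \<in> borel_measurable M" for f :: "int \<Rightarrow> real"
    using measurable_path_integral[OF assms] by (intro borel_measurable_times) auto
  then show "(\<lambda>\<omega>. fst (position c N J \<xi> t \<omega>)) \<in> borel_measurable M"
    and "(\<lambda>\<omega>. snd (position c N J \<xi> t \<omega>)) \<in> borel_measurable M"
    by (simp_all add: position_eq cong: measurable_cong)
qed

lemma AE_J: "AE \<omega> in M. J \<omega> \<in> {0, 1, 2, 3}"
proof -
  have "AE j in distr M (count_space UNIV) J. j \<in> {0, 1, 2, 3}"
    unfolding J_uniform by (simp add: AE_measure_pmf_iff)
  then show ?thesis
    using J_measurable by (subst (asm) AE_distr_iff) auto
qed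

lemma prob_J: "j \<in> {0, 1, 2, 3} \<Longrightarrow> prob {\<omega> \<in> space M. J \<omega> = j} = 1 / 4"
proof -
  assume j: "j \<in> {0, 1, 2, 3}"
  have "measure (distr M (count_space UNIV) J) {j} = prob (J -` {j} \<inter> space M)"
    using J_measurable by (intro measure_distr) auto
  then have "prob (J -` {j} \<inter> space M) = 1 / 4"
    unfolding J_uniform using j by (auto simp: measure_pmf_single)
  then show ?thesis by (simp add: vimage_def Int_def conj_commute)
qed

lemma AE_turn: "AE \<omega> in M. \<xi> k \<omega> \<in> {1, - 1, 2}"
proof -
  define E where "E j = {\<omega> \<in> space M. \<xi> k \<omega> = j}" for j
  have E: "E j \<in> events" for j
    using measurable_sets[OF turn_measurable, of "{j}" k] by (simp add: E_def vimage_def Int_def conj_commute)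
  have "prob (E 1 \<union> E (- 1) \<union> E 2) = prob (E 1) + prob (E (- 1)) + prob (E 2)"
    using E by (subst finite_measure_Union, (auto simp: E_def)[3])+ simp
  also have "\<dots> = 1"
    using turn_ccw turn_cw turn_reflect by (simp add: E_def)
  finally have "AE \<omega> in M. \<omega> \<in> E 1 \<union> E (- 1) \<union> E 2"
    by (rule AE_prob_1)
  then show ?thesis by (rule AE_mp) (auto simp: E_def)
qed

lemma even_heading_iff:
  "(\<forall>i\<le>n. even (heading \<omega> i)) \<longleftrightarrow> even (J \<omega>) \<and> (\<forall>k<n. even (\<xi> k \<omega>))"
proof (induction n)
  case (Suc n)
  have "heading \<omega> (Suc n) = heading \<omega> n + \<xi> n \<omega>"
    by (simp add: heading_def)
  then have "(\<forall>i\<le>Suc n. even (heading \<omega> i)) \<longleftrightarrow> (\<forall>i\<le>n. even (heading \<omega> i)) \<and> even (\<xi> n \<omega>)"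
    by (auto simp: le_Suc_eq)
  with Suc show ?case by (auto simp: less_Suc_eq)
qed (simp add: heading_def)

text \<open>The nonvanishing result concerns a fixed sequence y, while the turns are random. Only
  the initial index and the finite list of turns up to time t matter, and there are countably many
  such pairs, so their null sets can be united. Off this union a zero ordinate forces a constant
  vertical velocity, which must be 0 as t > 0.\<close>

lemma AE_diagonal_iff_even:
  assumes t: "0 < t"
  shows "AE \<omega> in M. snd (position c N J \<xi> t \<omega>) = 0 \<longleftrightarrow> (\<forall>i\<le>N t \<omega>. even (heading \<omega> i))"
proof -
  \<comment> \<open>Entries of l beyond its length are unspecified but never reached, since
    \<open>N s \<omega> \<le> N t \<omega> = length l\<close>.\<close>
  define y where "y j l i = snd (dir (j + (\<Sum>k<i. l ! k)))" for j and l :: "int list" and i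
  have "AE \<omega> in M. \<forall>j. \<forall>l. (\<exists>i\<le>length l. y j l i \<noteq> y j l 0) \<longrightarrow> N t \<omega> = length l \<longrightarrow>
      integral {0..t} (\<lambda>s. y j l (N s \<omega>)) \<noteq> 0"
    unfolding AE_all_countable
    by (intro allI AE_impI AE_path_integral_nonzero t)
  then show ?thesis
    using AE_space
  proof eventually_elim
    fix \<omega>
    assume *: "\<forall>j. \<forall>l. (\<exists>i\<le>length l. y j l i \<noteq> y j l 0) \<longrightarrow> N t \<omega> = length l \<longrightarrow>
      integral {0..t} (\<lambda>s. y j l (N s \<omega>)) \<noteq> 0" and \<omega>: "\<omega> \<in> space M"
    define l where "l = map (\<lambda>k. \<xi> k \<omega>) [0..<N t \<omega>]"
    have length_l: "length l = N t \<omega>" by (simp add: l_def)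
    have yl: "y (J \<omega>) l i = snd (dir (heading \<omega> i))" if "i \<le> N t \<omega>" for i
      using that by (simp add: y_def heading_def l_def)
    have N: "N s \<omega> \<le> N t \<omega>" if "s \<in> {0..t}" for s
      using that \<omega> by (intro N_le) auto
    have int: "integral {0..t} (\<lambda>s. y (J \<omega>) l (N s \<omega>)) = integral {0..t} (\<lambda>s. snd (dir (heading \<omega> (N s \<omega>))))"
      by (intro integral_cong yl N)
    have Y: "snd (position c N J \<xi> t \<omega>) = c * integral {0..t} (\<lambda>s. snd (dir (heading \<omega> (N s \<omega>))))"
      by (rule position_eq(2)[OF \<omega>])
    show "snd (position c N J \<xi> t \<omega>) = 0 \<longleftrightarrow> (\<forall>i\<le>N t \<omega>. even (heading \<omega> i))"
    proof
      assume "snd (position c N J \<xi> t \<omega>) = 0"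
      then have 0: "integral {0..t} (\<lambda>s. snd (dir (heading \<omega> (N s \<omega>)))) = 0"
        using Y speed_pos by simp
      then have y: "\<forall>i\<le>N t \<omega>. y (J \<omega>) l i = y (J \<omega>) l 0"
        using *[THEN spec[where x = "J \<omega>"], THEN spec[where x = l]] unfolding int length_l by blast
      have const: "snd (dir (heading \<omega> i)) = snd (dir (heading \<omega> 0))" if "i \<le> N t \<omega>" for i
        using y that unfolding yl[OF that, symmetric] yl[OF le0, symmetric] by blast
      have "integral {0..t} (\<lambda>s. snd (dir (heading \<omega> (N s \<omega>)))) = integral {0..t} (\<lambda>s. snd (dir (heading \<omega> 0)))"
        by (intro integral_cong const N)
      then have "snd (dir (heading \<omega> 0)) = 0"
        using 0 t by simp
      then show "\<forall>i\<le>N t \<omega>. even (heading \<omega> i)"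
        using const unfolding snd_dir_eq_0_iff[symmetric] by metis
    next
      assume ev: "\<forall>i\<le>N t \<omega>. even (heading \<omega> i)"
      have "integral {0..t} (\<lambda>s. snd (dir (heading \<omega> (N s \<omega>)))) = integral {0..t} (\<lambda>s. 0)"
        using ev N by (intro integral_cong) (auto simp: snd_dir_eq_0_iff)
      then show "snd (position c N J \<xi> t \<omega>) = 0"
        using Y by simp
    qed
  qed
qed

text \<open>Among the turns 1, -1, 2 only the reflection is even, and among the initial indices only
  0 and 2. Each reflection reverses the abscissa direction, so the path is the parity integral
  scaled by c and the initial sign; at most one term of the sum is nonzero.\<close>

lemma AE_diagonal_integrand:
  assumes t: "0 < t"
  shows "AE \<omega> in M. exp (\<i> * complex_of_real (\<alpha> * fst (position c N J \<xi> t \<omega>)))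
      * indicator {\<omega>. snd (position c N J \<xi> t \<omega>) = 0} \<omega> =
    (\<Sum>j\<in>{0, 2}. of_bool (J \<omega> = j \<and> (\<forall>k<N t \<omega>. \<xi> k \<omega> = 2))
      * exp (\<i> * of_real (\<alpha> * c * fst (dir j) * parity_integral t \<omega>)))"
proof -
  have "AE \<omega> in M. \<forall>k. \<xi> k \<omega> \<in> {1, - 1, 2}"
    unfolding AE_all_countable using AE_turn by blast
  with AE_diagonal_iff_even[OF t] AE_J show ?thesis
    using AE_space
  proof eventually_elim
    fix \<omega>
    assume Y: "snd (position c N J \<xi> t \<omega>) = 0 \<longleftrightarrow> (\<forall>i\<le>N t \<omega>. even (heading \<omega> i))"
      and J: "J \<omega> \<in> {0, 1, 2, 3}" and \<xi>: "\<forall>k. \<xi> k \<omega> \<in> {1, - 1, 2}" and \<omega>: "\<omega> \<in> space M"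
    have "even (\<xi> k \<omega>) \<longleftrightarrow> \<xi> k \<omega> = 2" for k
      using \<xi>[THEN spec[where x = k]] by auto
    moreover have "even (J \<omega>) \<longleftrightarrow> J \<omega> \<in> {0, 2}"
      using J by auto
    ultimately have Y: "snd (position c N J \<xi> t \<omega>) = 0 \<longleftrightarrow> J \<omega> \<in> {0, 2} \<and> (\<forall>k<N t \<omega>. \<xi> k \<omega> = 2)"
      unfolding Y even_heading_iff by simp
    have "fst (position c N J \<xi> t \<omega>) = c * fst (dir (J \<omega>)) * parity_integral t \<omega>"
      if 2: "\<forall>k<N t \<omega>. \<xi> k \<omega> = 2"
    proof -
      have "fst (dir (heading \<omega> (N s \<omega>))) = (- 1) ^ N s \<omega> * fst (dir (J \<omega>))" if "s \<in> {0..t}" for s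
      proof -
        have "N s \<omega> \<le> N t \<omega>" using that \<omega> by (intro N_le) auto
        then have "(\<Sum>k<N s \<omega>. \<xi> k \<omega>) = (\<Sum>k<N s \<omega>. 2)"
          using 2 by (intro sum.cong) auto
        then show ?thesis
          unfolding heading_def fst_dir_add_even[symmetric] by (simp add: mult.commute)
      qed
      then have "integral {0..t} (\<lambda>s. fst (dir (heading \<omega> (N s \<omega>)))) =
          integral {0..t} (\<lambda>s. (- 1) ^ N s \<omega> * fst (dir (J \<omega>)))"
        by (rule integral_cong)
      then show ?thesis
        unfolding position_eq(1)[OF \<omega>] parity_integral_def by simp
    qed
    note X = this
    show "exp (\<i> * complex_of_real (\<alpha> * fst (position c N J \<xi> t \<omega>)))
        * indicator {\<omega>. snd (position c N J \<xi> t \<omega>) = 0} \<omega> =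
      (\<Sum>j\<in>{0, 2}. of_bool (J \<omega> = j \<and> (\<forall>k<N t \<omega>. \<xi> k \<omega> = 2))
        * exp (\<i> * of_real (\<alpha> * c * fst (dir j) * parity_integral t \<omega>)))"
    proof (cases "J \<omega> \<in> {0, 2} \<and> (\<forall>k<N t \<omega>. \<xi> k \<omega> = 2)")
      case True
      then have "J \<omega> = 0 \<or> J \<omega> = 2" "\<forall>k<N t \<omega>. \<xi> k \<omega> = 2" by auto
      then show ?thesis
        using X Y by (auto simp: mult.assoc simp del: sum_of_bool_mult_eq)
    next
      case False
      then have "(\<Sum>j\<in>{0, 2}. of_bool (J \<omega> = j \<and> (\<forall>k<N t \<omega>. \<xi> k \<omega> = 2))
          * exp (\<i> * complex_of_real (\<alpha> * c * fst (dir j) * parity_integral t \<omega>))) = 0"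
        by (intro sum.neutral) auto
      then show ?thesis
        using Y False by simp
    qed
  qed
qed

section \<open>Independence of the initial direction, the clock and the turns\<close>

definition clock_algebra :: "'a measure" where
  "clock_algebra = sigma (space M) {N s -` A \<inter> space M | s A. 0 \<le> s}"

lemma space_clock_algebra [simp]: "space clock_algebra = space M"
  unfolding clock_algebra_def by (rule space_measure_of) auto

text \<open>Reduces membership in the source \<open>Clock\<close> to measurability with respect to
  \<open>clock_algebra\<close>, which passes to limits of grid sums.\<close>

lemma sets_clock_algebra: "sets clock_algebra = source_events M N J \<xi> Clock"
  unfolding clock_algebra_def source_events.simps by (rule sets_measure_of) auto

lemma measurable_N_clock: "0 \<le> s \<Longrightarrow> N s \<in> measurable clock_algebra (count_space UNIV)"
  by (rule measurableI) (auto simp: sets_clock_algebra intro!: sigma_sets.Basic)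

lemma measurable_parity_integral_clock:
  assumes "0 < t"
  shows "parity_integral t \<in> borel_measurable clock_algebra"
proof (rule borel_measurable_LIMSEQ_real)
  show "(\<lambda>l. parity_sum (t / real (Suc l)) (Suc l) \<omega>) \<longlonglongrightarrow> parity_integral t \<omega>"
    if "\<omega> \<in> space clock_algebra" for \<omega>
    using that assms by (intro parity_sum_tendsto) auto
  show "parity_sum (t / real (Suc l)) (Suc l) \<in> borel_measurable clock_algebra" for l
    unfolding grid_sum_def using assms
    by (intro borel_measurable_times borel_measurable_sum borel_measurable_const
        measurable_compose[OF measurable_N_clock]) auto
qed

text \<open>Given n events, the initial index contributes 1/4 and the n turns (1 - p - q)^n, both
  independently of the clock. Hence the indicator may be replaced by the weight (1 - p - q)^N(t) /
  4.\<close>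

lemma integral_turns:
  fixes a :: real
  assumes t: "0 < t" and j: "j \<in> {0, 1, 2, 3}"
  defines "f \<equiv> \<lambda>\<omega>. of_bool (J \<omega> = j \<and> (\<forall>k<N t \<omega>. \<xi> k \<omega> = 2)) * exp (\<i> * complex_of_real (a * parity_integral t \<omega>))"
  shows "integrable M f" and "(LINT \<omega>|M. f \<omega>) = parity_char t (1 - p - q) a / 4"
proof -
  define r where "r = 1 - p - q"
  have r: "\<bar>r\<bar> \<le> 1" using turn_probs by (auto simp: r_def)
  define G where "G \<omega> = exp (\<i> * complex_of_real (a * parity_integral t \<omega>))" for \<omega>
  have G_clock: "G \<in> borel_measurable clock_algebra"
    using measurable_parity_integral_clock[OF t] unfolding G_def by measurable
  have [measurable]: "N t \<in> measurable M (count_space UNIV)" "parity_integral t \<in> borel_measurable M"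
    "J \<in> measurable M (count_space UNIV)" "\<xi> k \<in> measurable M (count_space UNIV)" for k
    using t J_measurable turn_measurable by auto
  have G [measurable]: "G \<in> borel_measurable M"
    unfolding G_def by measurable
  have norm_G [simp]: "norm (G \<omega>) = 1" for \<omega>
    by (simp add: G_def)
  have f: "f = (\<lambda>\<omega>. of_bool (J \<omega> = j \<and> (\<forall>k<N t \<omega>. \<xi> k \<omega> = 2)) * G \<omega>)"
    by (simp add: f_def G_def)
  show int_f: "integrable M f"
  proof (rule integrable_const_bound[where B = 1])
    show "AE \<omega> in M. norm (f \<omega>) \<le> 1"
      by (simp add: f norm_mult)
    show "f \<in> borel_measurable M"
      unfolding f by measurable
  qed
  define g where "g \<omega> = of_real (r ^ N t \<omega>) * G \<omega> / 4" for \<omega>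
  have int_g: "integrable M g"
  proof (rule integrable_const_bound[where B = 1])
    have "\<bar>r\<bar> ^ n \<le> 4" for n
      using power_le_one[OF abs_ge_zero r, of n] by simp
    then show "AE \<omega> in M. norm (g \<omega>) \<le> 1"
      by (simp add: g_def norm_mult norm_divide norm_power)
    have "(\<lambda>\<omega>. complex_of_real (r ^ N t \<omega>) * G \<omega>) \<in> borel_measurable M"
      unfolding G_def by (rule measurable_parity_char[OF t])
    then show "g \<in> borel_measurable M"
      unfolding g_def by (intro borel_measurable_divide borel_measurable_const)
  qed
  have "(LINT \<omega>|M. f \<omega>) = (LINT \<omega>|M. g \<omega>)"
  proof (rule integral_eq_by_count[OF less_imp_le[OF t] int_f int_g])
    fix n
    \<comment> \<open>One factor per source; the indicator of \<open>N t \<omega> = n\<close> and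
      the phase are both functions of the clock and share a single factor.\<close>
    define X where "X i \<omega> = (case i of Initial \<Rightarrow> of_bool (J \<omega> = j)
      | Clock \<Rightarrow> of_bool (N t \<omega> = n) * G \<omega> | Turn k \<Rightarrow> of_bool (\<xi> k \<omega> = 2))" for i \<omega>
    define I where "I = insert Initial (insert Clock (Turn ` {..<n}))"
    have X_meas: "X i \<in> borel_measurable M" for i
      by (cases i) (simp_all add: X_def[abs_def])
    have vimage: "{X i -` A \<inter> space M | A. A \<in> sets borel} \<subseteq> {V -` A \<inter> space M | A. True}"
      if "X i = h \<circ> V" for i and h :: "int \<Rightarrow> complex" and V
      unfolding that vimage_comp[symmetric] by auto
    \<comment> \<open>Each factor generates a sub-algebra of its own source, so the independence of
      the sources passes to the factors.\<close>
    have "{X i -` A \<inter> space M | A. A \<in> sets borel} \<subseteq> source_events M N J \<xi> i" for i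
    proof (cases i)
      case Initial
      have "X i = (\<lambda>x. of_bool (x = j)) \<circ> J"
        by (simp add: X_def[abs_def] Initial o_def)
      from vimage[OF this] show ?thesis by (simp add: Initial)
    next
      case (Turn k)
      have "X i = (\<lambda>x. of_bool (x = 2)) \<circ> \<xi> k"
        by (simp add: X_def[abs_def] Turn o_def)
      from vimage[OF this] show ?thesis by (simp add: Turn)
    next
      case Clock
      have "(\<lambda>\<omega>. of_bool (N t \<omega> = n) :: complex) \<in> borel_measurable clock_algebra"
        using measurable_compose[OF measurable_N_clock[OF less_imp_le[OF t]], of "\<lambda>m. of_bool (m = n) :: complex" borel] by simp
      then have "X i \<in> borel_measurable clock_algebra"
        using G_clock unfolding X_def[abs_def] Clock by (simp add: borel_measurable_times)
      then show ?thesis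
        unfolding Clock sets_clock_algebra[symmetric] by (auto dest: measurable_sets)
    qed
    then have "indep_vars (\<lambda>_. borel) X UNIV"
      unfolding indep_vars_def2 using X_meas sources_indep
      by (auto intro: indep_sets_mono_sets)
    then have indep: "indep_vars (\<lambda>_. borel) X I"
      by (rule indep_vars_subset) auto
    have int_X: "integrable M (X i)" for i
    proof (rule integrable_const_bound[where B = 1])
      show "AE \<omega> in M. norm (X i \<omega>) \<le> 1"
        by (cases i) (simp_all add: X_def norm_mult)
    qed (rule X_meas)
    have prod_I: "(\<Prod>i\<in>I. h i) = h Initial * (h Clock * (\<Prod>k<n. h (Turn k)))" for h :: "source \<Rightarrow> complex"
    proof -
      have "Initial \<notin> insert Clock (Turn ` {..<n})" "Clock \<notin> Turn ` {..<n}" by auto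
      then show ?thesis by (simp add: I_def prod.reindex inj_on_def)
    qed
    have prob_eq: "(LINT \<omega>|M. of_bool (P \<omega>) :: complex) = of_real (prob {\<omega> \<in> space M. P \<omega>})"
      if [measurable]: "Measurable.pred M P" for P
    proof -
      have "(LINT \<omega>|M. of_bool (P \<omega>) :: complex) = (LINT \<omega>|M. complex_of_real (indicator {\<omega> \<in> space M. P \<omega>} \<omega>))"
        by (intro Bochner_Integration.integral_cong) (auto simp: indicator_def)
      then show ?thesis
        unfolding integral_complex_of_real by simp
    qed
    have E_J: "(LINT \<omega>|M. X Initial \<omega>) = 1 / 4"
      unfolding X_def using prob_eq[of "\<lambda>\<omega>. J \<omega> = j"] prob_J[OF j] by simp
    have E_turn: "(LINT \<omega>|M. X (Turn k) \<omega>) = of_real r" for k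
      unfolding X_def using prob_eq[of "\<lambda>\<omega>. \<xi> k \<omega> = 2"] turn_reflect[of k] by (simp add: r_def)
    have "(LINT \<omega>:{\<omega>\<in>space M. N t \<omega> = n}|M. f \<omega>) = (LINT \<omega>|M. (\<Prod>i\<in>I. X i \<omega>))"
      unfolding set_lebesgue_integral_def
    proof (intro Bochner_Integration.integral_cong refl)
      fix \<omega> assume "\<omega> \<in> space M"
      have "(\<Prod>k<n. X (Turn k) \<omega>) = of_bool (\<forall>k<n. \<xi> k \<omega> = 2)"
        by (induction n) (auto simp: X_def less_Suc_eq)
      with \<open>\<omega> \<in> space M\<close> show "indicat_real {\<omega>\<in>space M. N t \<omega> = n} \<omega> *\<^sub>R f \<omega> = (\<Prod>i\<in>I. X i \<omega>)"
        unfolding prod_I by (auto simp: X_def f)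
    qed
    also have "\<dots> = (\<Prod>i\<in>I. LINT \<omega>|M. X i \<omega>)"
      by (rule indep_vars_lebesgue_integral[OF _ indep int_X]) (simp add: I_def)
    also have "\<dots> = (LINT \<omega>|M. X Clock \<omega>) * (of_real r ^ n / 4)"
      unfolding prod_I by (simp add: E_J E_turn)
    also have "\<dots> = (LINT \<omega>|M. X Clock \<omega> * (of_real r ^ n / 4))"
      by simp
    also have "\<dots> = (LINT \<omega>:{\<omega>\<in>space M. N t \<omega> = n}|M. g \<omega>)"
      unfolding set_lebesgue_integral_def
      by (intro Bochner_Integration.integral_cong refl) (auto simp: X_def g_def)
    finally show "(LINT \<omega>:{\<omega>\<in>space M. N t \<omega> = n}|M. f \<omega>) = (LINT \<omega>:{\<omega>\<in>space M. N t \<omega> = n}|M. g \<omega>)" .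
  qed
  also have "\<dots> = parity_char t r a / 4"
    unfolding g_def parity_char_def G_def by simp
  finally show "(LINT \<omega>|M. f \<omega>) = parity_char t (1 - p - q) a / 4"
    by (simp add: r_def)
qed

lemma diagonal_char_eq:
  assumes t: "0 < t"
  shows "(LINT \<omega>|M. exp (\<i> * complex_of_real (\<alpha> * fst (position c N J \<xi> t \<omega>)))
      * indicator {\<omega>. snd (position c N J \<xi> t \<omega>) = 0} \<omega>) =
    (parity_char t (1 - p - q) (\<alpha> * c) + parity_char t (1 - p - q) (- (\<alpha> * c))) / 4"
proof -
  define F where "F j \<omega> = of_bool (J \<omega> = j \<and> (\<forall>k<N t \<omega>. \<xi> k \<omega> = 2))
      * exp (\<i> * complex_of_real (\<alpha> * c * fst (dir j) * parity_integral t \<omega>))" for j \<omega>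
  have F: "integrable M (F j)" "(LINT \<omega>|M. F j \<omega>) = parity_char t (1 - p - q) (\<alpha> * c * fst (dir j)) / 4"
    if "j \<in> {0, 2}" for j
    unfolding F_def using that by (intro integral_turns t; auto)+
  have [measurable]: "(\<lambda>\<omega>. fst (position c N J \<xi> t \<omega>)) \<in> borel_measurable M"
    "(\<lambda>\<omega>. snd (position c N J \<xi> t \<omega>)) \<in> borel_measurable M"
    using measurable_position[OF t] by auto
  have "(LINT \<omega>|M. exp (\<i> * complex_of_real (\<alpha> * fst (position c N J \<xi> t \<omega>)))
      * indicator {\<omega>. snd (position c N J \<xi> t \<omega>) = 0} \<omega>) = (LINT \<omega>|M. (\<Sum>j\<in>{0, 2}. F j \<omega>))"
  proof (rule integral_cong_AE)
    have "(\<lambda>\<omega>. exp (\<i> * complex_of_real (\<alpha> * fst (position c N J \<xi> t \<omega>)))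
        * (if snd (position c N J \<xi> t \<omega>) = 0 then 1 else 0)) \<in> borel_measurable M"
      by measurable
    then show "(\<lambda>\<omega>. exp (\<i> * complex_of_real (\<alpha> * fst (position c N J \<xi> t \<omega>)))
        * indicator {\<omega>. snd (position c N J \<xi> t \<omega>) = 0} \<omega>) \<in> borel_measurable M"
      by (simp add: indicator_def of_bool_def)
    show "(\<lambda>\<omega>. \<Sum>j\<in>{0, 2}. F j \<omega>) \<in> borel_measurable M"
      using F(1) by (intro borel_measurable_sum borel_measurable_integrable) auto
  qed (unfold F_def, rule AE_diagonal_integrand[OF t])
  also have "\<dots> = (\<Sum>j\<in>{0, 2}. LINT \<omega>|M. F j \<omega>)"
    using F(1) by (rule Bochner_Integration.integral_sum)
  also have "\<dots> = (parity_char t (1 - p - q) (\<alpha> * c) + parity_char t (1 - p - q) (- (\<alpha> * c))) / 4"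
    \<comment> \<open>The abscissa of \<open>dir 2\<close> is cos \<pi> = -1, which gives the
      argument - \<alpha> c.\<close>
    by (simp add: F(2) dir_def add_divide_distrib)
  finally show ?thesis .
qed

lemma parity_char_sum_eq_diagonal_formula:
  assumes t: "0 < t" and "rate\<^sup>2 * (1 - p - q)\<^sup>2 \<noteq> \<alpha>\<^sup>2 * c\<^sup>2"
  shows "(parity_char t (1 - p - q) (\<alpha> * c) + parity_char t (1 - p - q) (- (\<alpha> * c))) / 4 =
    diagonal_formula rate c p q t \<alpha>"
proof -
  define w where "w = diagonal_root rate c p q \<alpha>"
  have w2: "w\<^sup>2 = of_real ((rate * (1 - p - q))\<^sup>2 - (\<alpha> * c)\<^sup>2)"
    by (simp add: w_def diagonal_root_def power_mult_distrib)
  have "(rate * (1 - p - q))\<^sup>2 - (\<alpha> * c)\<^sup>2 \<noteq> 0"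
    using assms(2) by (simp add: power_mult_distrib)
  then have w: "w \<noteq> 0"
    using w2 by (metis of_real_eq_0_iff zero_power2)
  have r: "\<bar>1 - p - q\<bar> \<le> 1" using turn_probs by auto
  have w2': "w\<^sup>2 = of_real ((rate * (1 - p - q))\<^sup>2 - (- (\<alpha> * c))\<^sup>2)"
    using w2 by simp
  \<comment> \<open>The terms odd in b cancel, and the remaining cosh and sinh are expanded into
    exponentials.\<close>
  have sum: "rotation_flow w k b z + rotation_flow w k (- b) z =
      (1 + of_real k / w) * exp (z * w) + (1 - of_real k / w) * exp (- z * w)" for k b z
    using w by (simp add: rotation_flow_def cosh_def sinh_def scaleR_conv_of_real field_simps)
  show ?thesis
    unfolding parity_char_def telegraph_char[OF w2 w r t] telegraph_char[OF w2' w r t]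
      distrib_left[symmetric] sum diagonal_formula_def w_def[symmetric]
    by simp
qed

end

section \<open>The characteristic function on the diagonal, with the degenerate arguments as
  limits\<close>

theorem theorem5:
  fixes M :: "'a measure"
    and rate c p q t \<alpha> :: real
    and N :: "real \<Rightarrow> 'a \<Rightarrow> nat"
    and J :: "'a \<Rightarrow> int"
    and \<xi> :: "nat \<Rightarrow> 'a \<Rightarrow> int"
    and X Y :: "'a \<Rightarrow> real"
    and charfun :: complex
  assumes "orthogonal_motion M rate c p q N J \<xi>"
    and "t > 0"
    and "X = (\<lambda>\<omega>. fst (position c N J \<xi> t \<omega>))"
    and "Y = (\<lambda>\<omega>. snd (position c N J \<xi> t \<omega>))"
    and "charfun = (LINT \<omega>|M. exp (\<i> * complex_of_real (\<alpha> * X \<omega>)) * indicator {\<omega>. Y \<omega> = 0} \<omega>)"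
  shows "(rate\<^sup>2 * (1 - p - q)\<^sup>2 \<noteq> \<alpha>\<^sup>2 * c\<^sup>2 \<longrightarrow>
            charfun = diagonal_formula rate c p q t \<alpha>)
       \<and> (rate\<^sup>2 * (1 - p - q)\<^sup>2 = \<alpha>\<^sup>2 * c\<^sup>2 \<longrightarrow>
            ((\<lambda>a. diagonal_formula rate c p q t a) \<longlongrightarrow> charfun) (at \<alpha>))"
proof -
  interpret orthogonal_motion M rate c p q N J \<xi> by fact
  \<comment> \<open>\<Phi> is the characteristic function of the motion on the diagonal, continuous
    at every argument; the closed formula represents it wherever the root is nonzero.\<close>
  define \<Phi> where "\<Phi> = (\<lambda>a. (parity_char t (1 - p - q) (a * c) + parity_char t (1 - p - q) (- (a * c))) / 4)"
  have charfun: "charfun = \<Phi> \<alpha>"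
    unfolding assms(3-5) \<Phi>_def by (rule diagonal_char_eq[OF assms(2)])
  have \<Phi>: "\<Phi> a = diagonal_formula rate c p q t a" if "rate\<^sup>2 * (1 - p - q)\<^sup>2 \<noteq> a\<^sup>2 * c\<^sup>2" for a
    unfolding \<Phi>_def by (rule parity_char_sum_eq_diagonal_formula[OF assms(2) that])
  have r: "\<bar>1 - p - q\<bar> \<le> 1" using turn_probs by auto
  have "(\<Phi> \<longlongrightarrow> \<Phi> \<alpha>) (at \<alpha>)"
    unfolding \<Phi>_def
    by (intro tendsto_intros isCont_tendsto_compose[OF isCont_parity_char] assms(2) r) auto
  moreover have "eventually (\<lambda>a. \<Phi> a = diagonal_formula rate c p q t a) (at \<alpha>)"
    if deg: "rate\<^sup>2 * (1 - p - q)\<^sup>2 = \<alpha>\<^sup>2 * c\<^sup>2"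
  proof -
    \<comment> \<open>As c > 0, the root vanishes only at \<alpha> and - \<alpha>, and a punctured
      neighbourhood of \<alpha> avoids both.\<close>
    have "eventually (\<lambda>a. a \<noteq> \<alpha>) (at \<alpha>)" "eventually (\<lambda>a. a \<noteq> - \<alpha>) (at \<alpha>)"
      by (rule eventually_neq_at_within)+
    then show ?thesis
    proof eventually_elim
      fix a assume "a \<noteq> \<alpha>" "a \<noteq> - \<alpha>"
      then have "a\<^sup>2 \<noteq> \<alpha>\<^sup>2" by (simp add: power2_eq_iff)
      then show "\<Phi> a = diagonal_formula rate c p q t a"
        using deg speed_pos by (intro \<Phi>) simp
    qed
  qed
  ultimately show ?thesis
    unfolding charfun using \<Phi>[of \<alpha>] by (blast intro: Lim_transform_eventually)
qed

end
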